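(* In the setting of the context, let $\hat\beta$ be the Elastic net estimator with fixed $\mu>0$ and $\lambda=\sqrt{2q\log p}$ for a fixed $q>0$, and write $\eta=\rho/(1+\mu)$. Let $\mathrm{FP}_p=\sum_{j}\mathbb{P}(\beta_j=0,\hat\beta_j\ne0)$ and $\mathrm{FN}_p=\sum_j\mathbb{P}(\beta_j=\tau_p,\hat\beta_j=0)$. Then as $p\to\infty$, $\mathrm{FP}_p=L_pp^{1-\min\{q,\ \vartheta+f_1(\sqrt r,\sqrt q)\}}$, $\mathrm{FN}_p=L_pp^{1-\min\{\vartheta+f_2(\sqrt r,\sqrt q),\ 2\vartheta+f_3(\sqrt r,\sqrt q)\}}$, where $f_1=(\sqrt q-|\rho|\sqrt r)_+^2$ if $\sqrt r\le\frac{\sqrt q}{1+|\rho|}$; $f_1=\frac{1}{1-\rho^2}d^2_{|\rho|}\big((\sqrt q,\sqrt q),(|\rho|\sqrt r,\sqrt r)\big)$ if $\frac{\sqrt q}{1+|\rho|}<\sqrt r\le\frac{1+|\eta|}{1+|\rho|}\sqrt q$; $f_1=\frac{[(1-|\eta|)\sqrt q-(|\rho|-|\eta|)\sqrt r]_+^2}{1+\eta^2-2|\rho||\eta|}$ if $\sqrt r\ge\frac{1+|\eta|}{1+|\rho|}\sqrt q$; $f_2=\min\Big\{(\sqrt r-\sqrt q)_+^2,\ \frac{[(1-\rho\eta)\sqrt r-(1-|\eta|)\sqrt q]_+^2}{1+\eta^2-2\rho\eta}\Big\}$; $f_3=\frac{(1-\eta)^2[(1+\rho)\sqrt r-\sqrt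 q]_+^2}{1+\eta^2-2\rho\eta}$.
   Context: Setting: $p\to\infty$; $y=X\beta+z$, $z\sim N(0,I_n)$, $X^\top X=\mathrm{diag}(B,\dots,B,B_0)$ with $B=\begin{pmatrix}1&\rho\\ \rho&1\end{pmatrix}$, $\rho\in(-1,1)$, $B_0=B$ ($p$ even) or $1$ ($p$ odd); $\beta_j$ i.i.d. independent of $z$, $=\tau_p=\sqrt{2r\log p}$ w.p. $p^{-\vartheta}$ and $0$ otherwise, $\vartheta\in(0,1)$, $r>0$. Elastic net: $\hat\beta=\arg\min_\beta\{\|y-X\beta\|^2/2+\lambda\|\beta\|_1+(\mu/2)\|\beta\|^2\}$. $L_p$ denotes a generic multi-$\log(p)$ term ($L_pp^{\epsilon}\to\infty$, $L_pp^{-\epsilon}\to0$ for all $\epsilon>0$). For $\rho'\in(-1,1)$ and $u,v\in\mathbb{R}^2$, $d^2_{\rho'}(u,v)=(u_1-v_1)^2+(u_2-v_2)^2-2\rho'(u_1-v_1)(u_2-v_2)$. *)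

theory Defs
  imports "HOL-Probability.Probability"
begin

definition is_Lp :: "(nat \<Rightarrow> real) \<Rightarrow> bool" where
  "is_Lp a \<longleftrightarrow> (\<forall>eps>0. filterlim (\<lambda>p. a p * real p powr eps) at_top sequentially
                      \<and> ((\<lambda>p. a p * real p powr (- eps)) \<longlonglongrightarrow> 0))"

text \<open>Gram matrix X^T X = diag(B,...,B,B0), indices 0..p-1, blocks {2k,2k+1}.\<close>
definition gram :: "real \<Rightarrow> nat \<Rightarrow> nat \<Rightarrow> real" where
  "gram \<rho> j k = (if j = k then 1 else if j div 2 = k div 2 then \<rho> else 0)"

definition pospart :: "real \<Rightarrow> real" where
  "pospart x = max x 0"

definition dist2 :: "real \<Rightarrow> real \<times> real \<Rightarrow> real \<times> real \<Rightarrow> real" where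
  "dist2 \<rho>' u v = (fst u - fst v)^2 + (snd u - snd v)^2
                   - 2 * \<rho>' * (fst u - fst v) * (snd u - snd v)"

definition vecs :: "nat \<Rightarrow> (nat \<Rightarrow> real) set" where
  "vecs p = {b. \<forall>j\<ge>p. b j = 0}"

definition enet_obj :: "nat \<Rightarrow> nat \<Rightarrow> (nat \<Rightarrow> nat \<Rightarrow> real) \<Rightarrow> real \<Rightarrow> real
    \<Rightarrow> (nat \<Rightarrow> real) \<Rightarrow> (nat \<Rightarrow> real) \<Rightarrow> real" where
  "enet_obj n p X lam mu y b =
     (\<Sum>i<n. (y i - (\<Sum>j<p. X i j * b j))^2) / 2 + lam * (\<Sum>j<p. \<bar>b j\<bar>)
     + mu / 2 * (\<Sum>j<p. (b j)^2)"

definition enet :: "nat \<Rightarrow> nat \<Rightarrow> (nat \<Rightarrow> nat \<Rightarrow> real) \<Rightarrow> real \<Rightarrow> real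
    \<Rightarrow> (nat \<Rightarrow> real) \<Rightarrow> (nat \<Rightarrow> real)" where
  "enet n p X lam mu y = (THE b. b \<in> vecs p \<and>
       (\<forall>c\<in>vecs p. enet_obj n p X lam mu y b \<le> enet_obj n p X lam mu y c))"

definition beta_law :: "real \<Rightarrow> real \<Rightarrow> real measure" where
  "beta_law tau eps = measure_pmf (map_pmf (\<lambda>b. if b then tau else 0) (bernoulli_pmf eps))"

definition std_normal :: "real measure" where
  "std_normal = density lborel std_normal_density"

definition model :: "nat \<Rightarrow> nat \<Rightarrow> real \<Rightarrow> real \<Rightarrow> ((nat \<Rightarrow> real) \<times> (nat \<Rightarrow> real)) measure" where
  "model p n tau eps = (PiM {..<p} (\<lambda>_. beta_law tau eps)) \<Otimes>\<^sub>M (PiM {..<n} (\<lambda>_. std_normal))"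

definition response :: "nat \<Rightarrow> nat \<Rightarrow> (nat \<Rightarrow> nat \<Rightarrow> real) \<Rightarrow> (nat \<Rightarrow> real) \<Rightarrow> (nat \<Rightarrow> real) \<Rightarrow> nat \<Rightarrow> real" where
  "response n p X beta z = (\<lambda>i. if i < n then (\<Sum>j<p. X i j * beta j) + z i else 0)"

definition f1 :: "real \<Rightarrow> real \<Rightarrow> real \<Rightarrow> real \<Rightarrow> real" where
  "f1 \<rho> \<eta> sr sq =
    (if sr \<le> sq / (1 + \<bar>\<rho>\<bar>) then (pospart (sq - \<bar>\<rho>\<bar> * sr))^2
     else if sr \<le> (1 + \<bar>\<eta>\<bar>) / (1 + \<bar>\<rho>\<bar>) * sq
       then dist2 \<bar>\<rho>\<bar> (sq, sq) (\<bar>\<rho>\<bar> * sr, sr) / (1 - \<rho>^2)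
     else (pospart ((1 - \<bar>\<eta>\<bar>) * sq - (\<bar>\<rho>\<bar> - \<bar>\<eta>\<bar>) * sr))^2
            / (1 + \<eta>^2 - 2 * \<bar>\<rho>\<bar> * \<bar>\<eta>\<bar>))"

definition f2 :: "real \<Rightarrow> real \<Rightarrow> real \<Rightarrow> real \<Rightarrow> real" where
  "f2 \<rho> \<eta> sr sq = min ((pospart (sr - sq))^2)
     ((pospart ((1 - \<rho> * \<eta>) * sr - (1 - \<bar>\<eta>\<bar>) * sq))^2 / (1 + \<eta>^2 - 2 * \<rho> * \<eta>))"

definition f3 :: "real \<Rightarrow> real \<Rightarrow> real \<Rightarrow> real \<Rightarrow> real" where
  "f3 \<rho> \<eta> sr sq = (1 - \<eta>)^2 * (pospart ((1 + \<rho>) * sr - sq))^2 / (1 + \<eta>^2 - 2 * \<rho> * \<eta>)"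

definition enet_FP :: "nat \<Rightarrow> nat \<Rightarrow> (nat \<Rightarrow> nat \<Rightarrow> real) \<Rightarrow> real \<Rightarrow> real \<Rightarrow> real \<Rightarrow> real \<Rightarrow> real" where
  "enet_FP p n X tau eps lam mu =
     (\<Sum>j<p. measure (model p n tau eps)
        {\<omega> \<in> space (model p n tau eps). fst \<omega> j = 0 \<and>
            enet n p X lam mu (response n p X (fst \<omega>) (snd \<omega>)) j \<noteq> 0})"

definition enet_FN :: "nat \<Rightarrow> nat \<Rightarrow> (nat \<Rightarrow> nat \<Rightarrow> real) \<Rightarrow> real \<Rightarrow> real \<Rightarrow> real \<Rightarrow> real \<Rightarrow> real" where
  "enet_FN p n X tau eps lam mu =
     (\<Sum>j<p. measure (model p n tau eps)
        {\<omega> \<in> space (model p n tau eps). fst \<omega> j = tau \<and>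
            enet n p X lam mu (response n p X (fst \<omega>) (snd \<omega>)) j = 0})"

end

theory Submission
  imports Defs "HOL-Real_Asymp.Real_Asymp"
begin

text \<open>Since the Gram matrix is block diagonal, the stationarity conditions decouple into pairs:
  with \<open>W = X\<^sup>T y\<close> and \<open>S\<close> soft thresholding at \<open>\<lambda>\<close>, a coordinate \<open>j\<close> with partner \<open>k\<close> is estimated
  by zero iff \<open>\<bar>W\<^sub>j - \<eta> S(W\<^sub>k)\<bar> \<le> \<lambda>\<close>. In units of \<open>sqrt (2 log p)\<close> this is a fixed planar region, and
  \<open>(W\<^sub>j, W\<^sub>k)\<close> is Gaussian around one of four centres, so each error probability is
  \<open>p\<close> to the minus squared Mahalanobis distance from the centre to the region (or its complement), up to
  subpolynomial factors. The functions \<open>f2\<close>, \<open>f3\<close> are these distances, and so is \<open>f1\<close> as long as it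
  is below \<open>q\<close>. Upper bounds come from covering the region by half-planes; lower bounds from one
  half-plane touching the region at the nearest point, from which half-planes of strictly smaller
  order are removed.\<close>

section \<open>Zeros of the elastic net for a block-diagonal Gram matrix\<close>

text \<open>Near the corner (Q, Q) of the zero region, for eta >= 0, the active side is an
  intersection of two half-planes, x >= Q and x - eta y >= (1 - eta) Q, and the zero side is a
  union. A convex corner can itself be the nearest point, hence the middle branch of
  \<open>f1\<close>; for a union the distance is the smaller of two, hence the minimum in
  \<open>f2\<close>. When \<open>f1\<close> exceeds q, other parts of the active region may be
  nearer, but they still cost at least q, which a pair of zero coefficients contributes anyway. The
  noise space and the coordinate vary with p, so lower bounds read: eventually in p, for all
  probability spaces carrying such a pair. With this order of quantifiers one threshold for p serves
  all coordinates. Negative rho is reduced to positive rho by reflecting the coordinate without a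
  signal. With two signals there is none, so that case treats both signs directly. For odd p the
  last coordinate has no partner. Index p - 1 is left out of the lower bounds, and the upper bounds
  treat an unpaired coordinate separately.\<close>

definition soft :: "real \<Rightarrow> real \<Rightarrow> real" where
  "soft l x = x - max (- l) (min l x)"

lemma soft_lipschitz: "0 \<le> l \<Longrightarrow> \<bar>soft l x - soft l y\<bar> \<le> \<bar>x - y\<bar>"
  by (auto simp: soft_def max_def min_def)

lemma soft_eq_0_iff: "0 \<le> l \<Longrightarrow> soft l x = 0 \<longleftrightarrow> \<bar>x\<bar> \<le> l"
  by (auto simp: soft_def max_def min_def)

lemma soft_scale: "0 < s \<Longrightarrow> soft (l * s) (x * s) = soft l x * s"
  using mult_le_cancel_right_pos [of s]
  by (simp add: soft_def max_mult_distrib_right min_mult_distrib_right left_diff_distrib)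

text \<open>\<open>soft l x\<close> is x minus its projection onto [-l, l]. If it equals c * b with
  c > 0, then x - c * b is this projection and is l times a subgradient of the absolute value at b;
  the two conclusions express exactly that.\<close>

lemma soft_subgradient:
  assumes "0 \<le> l" "0 < c" "c * b = soft l x"
  shows "\<bar>x - c * b\<bar> \<le> l" "(x - c * b) * b = l * \<bar>b\<bar>"
proof -
  show "\<bar>x - c * b\<bar> \<le> l"
    unfolding assms(3) using assms(1) by (auto simp: soft_def max_def min_def)
  consider "x > l" | "x < - l" | "\<bar>x\<bar> \<le> l" by linarith
  then show "(x - c * b) * b = l * \<bar>b\<bar>"
  proof cases
    case 1
    then have e: "c * b = x - l" using assms by (auto simp: soft_def)
    then have "0 < c * b" using 1 by simp
    then have "0 < b" using assms(2) by (simp add: zero_less_mult_iff)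
    then show ?thesis using e by simp
  next
    case 2
    then have e: "c * b = x + l" using assms by (auto simp: soft_def)
    then have "c * b < 0" using 2 by simp
    then have "b < 0" using assms(2) by (simp add: mult_less_0_iff)
    then show ?thesis using e by simp
  next
    case 3
    then have "c * b = 0" using assms soft_eq_0_iff [of l x] by simp
    then show ?thesis using assms(2) by simp
  qed
qed

text \<open>Solving each equation for its own unknown gives two updates that are |rho|-Lipschitz,
  because soft thresholding is nonexpansive and 1 + mu > 1. Their composition is a contraction of
  the line, and its fixed point yields a solution.\<close>

lemma kkt_pair_ex:
  assumes "\<bar>\<rho>\<bar> < 1" "0 < \<mu>" "0 \<le> l"
  shows "\<exists>b1 b2. (1 + \<mu>) * b1 = soft l (w1 - \<rho> * b2) \<and> (1 + \<mu>) * b2 = soft l (w2 - \<rho> * b1)"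
proof -
  define g where "g w b = soft l (w - \<rho> * b) / (1 + \<mu>)" for w b
  have lip: "\<bar>g w x - g w y\<bar> \<le> \<bar>\<rho>\<bar> * \<bar>x - y\<bar>" for w x y
  proof -
    have "\<bar>g w x - g w y\<bar> = \<bar>soft l (w - \<rho> * x) - soft l (w - \<rho> * y)\<bar> / (1 + \<mu>)"
      using assms by (simp add: g_def diff_divide_distrib [symmetric])
    also have "\<dots> \<le> \<bar>soft l (w - \<rho> * x) - soft l (w - \<rho> * y)\<bar>"
      using assms by (simp add: divide_le_eq mult_left_le algebra_simps)
    also have "\<dots> \<le> \<bar>(w - \<rho> * x) - (w - \<rho> * y)\<bar>"
      using soft_lipschitz assms by blast
    also have "\<dots> = \<bar>\<rho> * (x - y)\<bar>" by (simp add: algebra_simps abs_minus_commute)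
    finally show ?thesis by (simp add: abs_mult)
  qed
  have "dist (g w1 (g w2 x)) (g w1 (g w2 y)) \<le> \<bar>\<rho>\<bar> * dist x y" for x y
  proof -
    have "\<bar>g w1 (g w2 x) - g w1 (g w2 y)\<bar> \<le> \<bar>\<rho>\<bar> * (\<bar>\<rho>\<bar> * \<bar>x - y\<bar>)"
      by (rule order_trans [OF lip]) (intro mult_left_mono lip abs_ge_zero)
    also have "\<dots> \<le> \<bar>\<rho>\<bar> * \<bar>x - y\<bar>"
      using assms by (intro mult_left_mono mult_left_le_one_le) auto
    finally show ?thesis by (simp add: dist_real_def)
  qed
  then have "\<exists>!x. g w1 (g w2 x) = x"
    using assms by (intro banach_fix_type [of "\<bar>\<rho>\<bar>"]) auto
  then obtain x where x: "g w1 (g w2 x) = x" by blast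
  have "(1 + \<mu>) * g w b = soft l (w - \<rho> * b)" for w b
    using assms by (simp add: g_def)
  from this[of w1 "g w2 x"] this[of w2 x] show ?thesis
    unfolding x by blast
qed

text \<open>If b1 vanishes, the second equation determines b2. Conversely, the inequality says that
  (0, c) also solves the system; comparing the two solutions gives (1 + mu)|b1| <= |b2 - c| and (1 +
  mu)|b2 - c| <= |b1|, which forces b1 = 0 as mu > 0.\<close>

lemma kkt_pair_zero_iff:
  assumes "\<bar>\<rho>\<bar> < 1" and mu: "0 < \<mu>" and "0 \<le> l"
    and b1: "(1 + \<mu>) * b1 = soft l (w1 - \<rho> * b2)" and b2: "(1 + \<mu>) * b2 = soft l (w2 - \<rho> * b1)"
  shows "b1 = 0 \<longleftrightarrow> \<bar>w1 - \<rho> / (1 + \<mu>) * soft l w2\<bar> \<le> l"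
proof
  assume "b1 = 0"
  then have "b2 = soft l w2 / (1 + \<mu>)" "\<bar>w1 - \<rho> * b2\<bar> \<le> l"
    using b1 b2 assms(1-3) soft_eq_0_iff [of l "w1 - \<rho> * b2"] by (auto simp: field_simps)
  then show "\<bar>w1 - \<rho> / (1 + \<mu>) * soft l w2\<bar> \<le> l" by simp
next
  assume le: "\<bar>w1 - \<rho> / (1 + \<mu>) * soft l w2\<bar> \<le> l"
  define c where "c = soft l w2 / (1 + \<mu>)"
  have c: "(1 + \<mu>) * c = soft l w2" using assms by (simp add: c_def)
  have "soft l (w1 - \<rho> * c) = 0"
    using le assms soft_eq_0_iff [of l "w1 - \<rho> * c"] by (simp add: c_def)
  then have "(1 + \<mu>) * \<bar>b1\<bar> = \<bar>soft l (w1 - \<rho> * b2) - soft l (w1 - \<rho> * c)\<bar>"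
    unfolding b1 [symmetric] using mu by (simp add: abs_mult)
  also have "\<dots> \<le> \<bar>(w1 - \<rho> * b2) - (w1 - \<rho> * c)\<bar>" using soft_lipschitz assms by blast
  also have "\<dots> = \<bar>\<rho> * (b2 - c)\<bar>" by (simp add: algebra_simps abs_minus_commute)
  also have "\<dots> \<le> \<bar>b2 - c\<bar>" using assms by (simp add: abs_mult mult_left_le_one_le)
  finally have 1: "(1 + \<mu>) * \<bar>b1\<bar> \<le> \<bar>b2 - c\<bar>" .
  have "(1 + \<mu>) * \<bar>b2 - c\<bar> = \<bar>(1 + \<mu>) * b2 - (1 + \<mu>) * c\<bar>"
    using mu by (simp only: right_diff_distrib [symmetric] abs_mult)
  also have "\<dots> \<le> \<bar>(w2 - \<rho> * b1) - w2\<bar>" unfolding b2 c using soft_lipschitz assms by blast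
  also have "\<dots> \<le> \<bar>b1\<bar>" using assms by (simp add: abs_mult mult_left_le_one_le)
  finally have 2: "(1 + \<mu>) * \<bar>b2 - c\<bar> \<le> \<bar>b1\<bar>" .
  have "\<bar>b2 - c\<bar> \<le> (1 + \<mu>) * \<bar>b2 - c\<bar>" using assms by (simp add: algebra_simps)
  then have "\<mu> * \<bar>b1\<bar> \<le> 0" using 1 2 by (simp add: algebra_simps)
  then show "b1 = 0" using assms by (simp add: mult_le_0_iff)
qed

text \<open>For odd p the last index p - 1 is even and its partner p lies outside the design, so
  \<open>nbr j < p\<close> tells blocks of size two from the block of size one.\<close>

definition nbr :: "nat \<Rightarrow> nat" where
  "nbr j = (if even j then Suc j else j - 1)"

lemma nbr_nbr [simp]: "nbr (nbr j) = j"
  by (cases j) (simp_all add: nbr_def)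

lemma nbr_neq [simp]: "nbr j \<noteq> j" "j \<noteq> nbr j"
  by (cases j; simp add: nbr_def)+

lemma div2_eq_iff: "j div 2 = k div 2 \<longleftrightarrow> k = j \<or> k = nbr j"
proof (cases "even j")
  case True
  then obtain i where "j = 2 * i" by blast
  then show ?thesis by (auto simp: nbr_def)
next
  case False
  then obtain i where "j = 2 * i + 1" by (blast elim: oddE)
  then show ?thesis by (auto simp: nbr_def)
qed

lemma gram_sum:
  assumes "j < p"
  shows "(\<Sum>k<p. gram \<rho> j k * b k) = b j + (if nbr j < p then \<rho> * b (nbr j) else 0)"
proof -
  have "(\<Sum>k<p. gram \<rho> j k * b k)
      = (\<Sum>k<p. (if k = j then b j else 0) + (if k = nbr j then \<rho> * b (nbr j) else 0))"
    by (intro sum.cong) (auto simp: gram_def div2_eq_iff)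
  also have "\<dots> = b j + (if nbr j < p then \<rho> * b (nbr j) else 0)"
    using assms by (auto simp: sum.distrib)
  finally show ?thesis .
qed

definition score :: "nat \<Rightarrow> (nat \<Rightarrow> nat \<Rightarrow> real) \<Rightarrow> (nat \<Rightarrow> real) \<Rightarrow> nat \<Rightarrow> real" where
  "score n X y j = (\<Sum>i<n. X i j * y i)"

text \<open>Stationarity gives more than minimality: moving from b to c raises the objective by at
  least mu / 2 times the squared distance. This one inequality yields minimality and uniqueness, and
  so evaluates the definite description in \<open>enet\<close>.\<close>

lemma enet_eqI:
  assumes mu: "0 < \<mu>" and l: "0 \<le> l"
    and design: "\<And>j k. j < p \<Longrightarrow> k < p \<Longrightarrow> (\<Sum>i<n. X i j * X i k) = gram \<rho> j k"
    and b: "b \<in> vecs p"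
    and kkt: "\<And>j. j < p \<Longrightarrow> (1 + \<mu>) * b j = soft l (score n X y j - \<rho> * b (nbr j))"
  shows "enet n p X l \<mu> y = b"
proof -
  have gap: "enet_obj n p X l \<mu> y b + \<mu> / 2 * (\<Sum>j<p. (c j - b j)\<^sup>2) \<le> enet_obj n p X l \<mu> y c" for c
  proof -
    define d where "d j = c j - b j" for j
    define e where "e i = y i - (\<Sum>j<p. X i j * b j)" for i
    have c: "c j = b j + d j" for j by (simp add: d_def)
    have "y i - (\<Sum>j<p. X i j * c j) = e i - (\<Sum>j<p. X i j * d j)" for i
      by (simp add: e_def c sum.distrib distrib_left)
    then have "(\<Sum>i<n. (y i - (\<Sum>j<p. X i j * c j))\<^sup>2)
        = (\<Sum>i<n. (e i)\<^sup>2) - 2 * (\<Sum>i<n. e i * (\<Sum>j<p. X i j * d j)) + (\<Sum>i<n. (\<Sum>j<p. X i j * d j)\<^sup>2)"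
      by (simp add: power2_diff sum.distrib sum_subtractf sum_distrib_left mult.assoc)
    \<comment> \<open>Only the sign of the quadratic form of the design is used; the strict gain
      comes from the ridge term.\<close>
    moreover have "0 \<le> (\<Sum>i<n. (\<Sum>j<p. X i j * d j)\<^sup>2)" by (simp add: sum_nonneg)
    moreover have "(\<Sum>i<n. e i * (\<Sum>j<p. X i j * d j)) = (\<Sum>j<p. (score n X y j - \<rho> * b (nbr j) - b j) * d j)"
    proof -
      have "(\<Sum>i<n. e i * (\<Sum>j<p. X i j * d j)) = (\<Sum>j<p. (\<Sum>i<n. X i j * e i) * d j)"
        unfolding sum_distrib_left sum_distrib_right
        by (subst sum.swap) (simp add: ac_simps)
      moreover have "(\<Sum>i<n. X i j * e i) = score n X y j - \<rho> * b (nbr j) - b j" if "j < p" for j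
      proof -
        have "(\<Sum>i<n. X i j * (\<Sum>k<p. X i k * b k)) = (\<Sum>k<p. (\<Sum>i<n. X i j * X i k) * b k)"
          unfolding sum_distrib_left sum_distrib_right
          by (subst sum.swap) (simp add: ac_simps)
        also have "\<dots> = (\<Sum>k<p. gram \<rho> j k * b k)"
          using design that by (intro sum.cong) auto
        also have "\<dots> = b j + \<rho> * b (nbr j)" 
          using gram_sum [OF that] b by (auto simp: vecs_def)
        finally show ?thesis by (simp add: e_def score_def right_diff_distrib sum_subtractf)
      qed
      ultimately show ?thesis by simp
    qed
    moreover have "0 \<le> (\<Sum>j<p. l * \<bar>c j\<bar> - l * \<bar>b j\<bar> + \<mu> / 2 * (c j)\<^sup>2 - \<mu> / 2 * (b j)\<^sup>2 - \<mu> / 2 * (c j - b j)\<^sup>2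
        - (score n X y j - \<rho> * b (nbr j) - b j) * d j)"
    proof (intro sum_nonneg)
      fix j assume "j \<in> {..<p}"
      \<comment> \<open>By stationarity g is l times a subgradient at \<open>b j\<close>. The ridge
        terms below combine through c^2 - b^2 - (c - b)^2 = 2 b (c - b).\<close>
      define g where "g = score n X y j - \<rho> * b (nbr j) - (1 + \<mu>) * b j"
      have "\<bar>g\<bar> \<le> l" and gb: "g * b j = l * \<bar>b j\<bar>"
        using soft_subgradient [OF l _ kkt, of j] mu \<open>j \<in> {..<p}\<close> by (auto simp: g_def)
      have "g * c j \<le> \<bar>g\<bar> * \<bar>c j\<bar>" by (simp add: abs_mult [symmetric])
      also have "\<dots> \<le> l * \<bar>c j\<bar>" using \<open>\<bar>g\<bar> \<le> l\<close> by (simp add: mult_right_mono)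
      finally have "0 \<le> l * \<bar>c j\<bar> - l * \<bar>b j\<bar> - g * (c j - b j)" using gb by (simp add: algebra_simps)
      also have "\<dots> = l * \<bar>c j\<bar> - l * \<bar>b j\<bar> + \<mu> / 2 * (c j)\<^sup>2 - \<mu> / 2 * (b j)\<^sup>2 - \<mu> / 2 * (c j - b j)\<^sup>2
        - (score n X y j - \<rho> * b (nbr j) - b j) * d j"
        by (simp add: g_def d_def power2_eq_square algebra_simps)
      finally show "0 \<le> \<dots>" .
    qed
    ultimately show ?thesis
        by (simp add: enet_obj_def e_def sum.distrib sum_subtractf sum_distrib_left [symmetric]
          sum_divide_distrib [symmetric] diff_divide_distrib add_divide_distrib)
  qed
  show ?thesis unfolding enet_def
  proof (rule the_equality)
    show "b \<in> vecs p \<and> (\<forall>c\<in>vecs p. enet_obj n p X l \<mu> y b \<le> enet_obj n p X l \<mu> y c)"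
    proof (intro conjI ballI b)
      fix c
      have "0 \<le> \<mu> / 2 * (\<Sum>j<p. (c j - b j)\<^sup>2)" using mu by (simp add: sum_nonneg)
      then show "enet_obj n p X l \<mu> y b \<le> enet_obj n p X l \<mu> y c" using gap [of c] by linarith
    qed
  next
    fix c assume c: "c \<in> vecs p \<and> (\<forall>c'\<in>vecs p. enet_obj n p X l \<mu> y c \<le> enet_obj n p X l \<mu> y c')"
    then have "\<mu> / 2 * (\<Sum>j<p. (c j - b j)\<^sup>2) \<le> 0" using gap [of c] b by fastforce
    then have "(\<Sum>j<p. (c j - b j)\<^sup>2) \<le> 0" using mu by (simp add: mult_le_0_iff)
    then have "(\<Sum>j<p. (c j - b j)\<^sup>2) = 0" by (intro antisym sum_nonneg) auto
    then have "\<forall>j<p. c j = b j" by (simp add: sum_nonneg_eq_0_iff)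
    moreover have "\<forall>j\<ge>p. c j = b j" using b c by (simp add: vecs_def)
    ultimately show "c = b" by (metis ext not_le_imp_less)
  qed
qed

lemma enet_zero_iff:
  assumes mu: "0 < \<mu>" and l: "0 \<le> l" and rho: "\<bar>\<rho>\<bar> < 1"
    and design: "\<And>j k. j < p \<Longrightarrow> k < p \<Longrightarrow> (\<Sum>i<n. X i j * X i k) = gram \<rho> j k"
    and j: "j < p"
  shows "enet n p X l \<mu> y j = 0 \<longleftrightarrow>
    \<bar>score n X y j - \<rho> / (1 + \<mu>) * (if nbr j < p then soft l (score n X y (nbr j)) else 0)\<bar> \<le> l"
proof -
  define w where "w = score n X y"
  have "\<forall>k. \<exists>c. (1 + \<mu>) * fst c = soft l (w (2 * k) - \<rho> * snd c)
      \<and> (1 + \<mu>) * snd c = soft l (w (Suc (2 * k)) - \<rho> * fst c)"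
    using kkt_pair_ex [OF rho mu l] by simp
  from choice [OF this] obtain c where
    c: "\<And>k. (1 + \<mu>) * fst (c k) = soft l (w (2 * k) - \<rho> * snd (c k))
      \<and> (1 + \<mu>) * snd (c k) = soft l (w (Suc (2 * k)) - \<rho> * fst (c k))" by blast
  define b1 b2 where "b1 k = fst (c k)" and "b2 k = snd (c k)" for k
  have b1: "(1 + \<mu>) * b1 k = soft l (w (2 * k) - \<rho> * b2 k)"
    and b2: "(1 + \<mu>) * b2 k = soft l (w (Suc (2 * k)) - \<rho> * b1 k)" for k
    using c [of k] by (simp_all add: b1_def b2_def)
  \<comment> \<open>The block solutions are assembled, cut off at p; a block of size one gets the
    scalar solution instead.\<close>
  define b where "b j = (if p \<le> j then 0 else if p \<le> nbr j then soft l (w j) / (1 + \<mu>)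
     else if even j then b1 (j div 2) else b2 (j div 2))" for j
  have kkt: "(1 + \<mu>) * b j = soft l (w j - \<rho> * b (nbr j))" if "j < p" for j
  proof (cases "p \<le> nbr j")
    case True
    then show ?thesis using that mu by (simp add: b_def)
  next
    case False
    show ?thesis
    proof (cases "even j")
      case True
      then obtain k where k: "j = 2 * k" by blast
      show ?thesis using that False b1 [of k] by (simp add: b_def k nbr_def)
    next
      case odd: False
      then obtain k where k: "j = Suc (2 * k)" by (auto elim: oddE)
      show ?thesis using that False b2 [of k] by (simp add: b_def k nbr_def)
    qed
  qed
  have enet: "enet n p X l \<mu> y = b"
    using kkt by (intro enet_eqI [OF mu l design]) (auto simp: b_def vecs_def w_def)
  show ?thesis
  proof (cases "nbr j < p")
    case True
    then have "(1 + \<mu>) * b (nbr j) = soft l (w (nbr j) - \<rho> * b j)" using kkt [of "nbr j"] by simp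
    from kkt_pair_zero_iff [OF rho mu l kkt [OF j] this] show ?thesis
      using True by (simp add: enet w_def)
  next
    case False
    have "b j = 0 \<longleftrightarrow> soft l (w j) = 0" using False j mu by (simp add: b_def)
    then show ?thesis using False l by (simp add: enet w_def soft_eq_0_iff)
  qed
qed

section \<open>Gaussian half-planes\<close>

lemma prob_space_std_normal: "prob_space std_normal"
  unfolding std_normal_def by (rule prob_space_normal_density) simp

lemma sets_std_normal [measurable_cong]: "sets std_normal = sets borel"
  by (simp add: std_normal_def)

lemma space_std_normal [simp]: "space std_normal = UNIV"
  by (simp add: std_normal_def)

lemma linear_std_normal:
  fixes a :: "nat \<Rightarrow> real"
  assumes v: "v = (\<Sum>i<n. (a i)\<^sup>2)" "0 < v"
  shows "distributed (PiM {..<n} (\<lambda>_. std_normal)) lborel (\<lambda>z. \<Sum>i<n. a i * z i) (normal_density 0 (sqrt v))"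
proof -
  let ?N = "PiM {..<n} (\<lambda>_. std_normal)"
  interpret N: prob_space ?N by (intro prob_space_PiM prob_space_std_normal)
  \<comment> \<open>Zero coefficients are discarded, since a constant summand has no normal density;
    v > 0 leaves at least one index.\<close>
  define I where "I = {i\<in>{..<n}. a i \<noteq> 0}"
  have "I \<noteq> {}"
  proof
    assume "I = {}"
    then have "v = 0" unfolding v(1) I_def by (intro sum.neutral) auto
    with v(2) show False by simp
  qed
  have marg: "distr ?N borel (\<lambda>z. z i) = std_normal" if "i < n" for i
  proof -
    have "distr ?N borel (\<lambda>z. z i) = distr ?N std_normal (\<lambda>z. z i)"
      by (intro distr_cong) (simp_all add: sets_std_normal)
    also have "\<dots> = std_normal"
      using distr_PiM_component [of "{..<n}" "\<lambda>_. std_normal" i] that prob_space_std_normal by simp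
    finally show ?thesis .
  qed
  have ind: "N.indep_vars (\<lambda>_. borel) (\<lambda>i z. z i) {..<n}"
  proof (subst N.indep_vars_iff_distr_eq_PiM')
    show "{..<n} \<noteq> {}" using \<open>I \<noteq> {}\<close> by (auto simp: I_def)
    show "(\<lambda>z. z i) \<in> borel_measurable ?N" if "i \<in> {..<n}" for i using that by measurable
    \<comment> \<open>Independence is read off from the joint law: it is the product measure itself,
      because both products carry the same sigma-algebra and restriction is the identity on
      extensional functions.\<close>
    have "sets (PiM {..<n} (\<lambda>_. borel :: real measure)) = sets ?N"
      by (intro sets_PiM_cong) (simp_all add: sets_std_normal)
    then have "distr ?N (PiM {..<n} (\<lambda>_. borel)) (\<lambda>z. \<lambda>i\<in>{..<n}. z i) = distr ?N ?N (\<lambda>z. z)"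
      by (intro distr_cong) (auto simp: space_PiM PiE_def extensional_def restrict_def)
    also have "\<dots> = ?N" by simp
    also have "\<dots> = PiM {..<n} (\<lambda>i. distr ?N borel (\<lambda>z. z i))"
      by (intro PiM_cong) (simp_all add: marg)
    finally show "distr ?N (PiM {..<n} (\<lambda>_. borel)) (\<lambda>z. \<lambda>i\<in>{..<n}. z i)
        = PiM {..<n} (\<lambda>i. distr ?N borel (\<lambda>z. z i))" .
  qed
  have ind': "N.indep_vars (\<lambda>_. borel) (\<lambda>i z. a i * z i) I"
    by (rule N.indep_vars_compose2 [OF N.indep_vars_subset [OF ind]]) (auto simp: I_def)
  have dist: "distributed ?N lborel (\<lambda>z. a i * z i) (normal_density 0 \<bar>a i\<bar>)" if "i \<in> I" for i
  proof -
    have "i < n" "a i \<noteq> 0" using that by (auto simp: I_def)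
    have "distr ?N lborel (\<lambda>z. z i) = distr ?N borel (\<lambda>z. z i)"
      by (intro distr_cong) simp_all
    then have "distributed ?N lborel (\<lambda>z. z i) std_normal_density"
      using marg [OF \<open>i < n\<close>] \<open>i < n\<close> by (auto simp: distributed_def std_normal_def)
    from N.normal_density_affine [OF this, of "a i" 0] \<open>a i \<noteq> 0\<close> show ?thesis by simp
  qed
  have "distributed ?N lborel (\<lambda>z. \<Sum>i\<in>I. a i * z i) (normal_density (\<Sum>i\<in>I. 0) (sqrt (\<Sum>i\<in>I. \<bar>a i\<bar>\<^sup>2)))"
    by (rule N.sum_indep_normal [OF _ \<open>I \<noteq> {}\<close> ind' _ dist]) (auto simp: I_def)
  moreover have "(\<Sum>i\<in>I. a i * z i) = (\<Sum>i<n. a i * z i)" for z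
    by (rule sum.mono_neutral_left) (auto simp: I_def)
  moreover have "(\<Sum>i\<in>I. (a i)\<^sup>2) = v"
    unfolding v(1) by (rule sum.mono_neutral_left) (auto simp: I_def)
  ultimately show ?thesis by simp
qed

section \<open>Tails of the standard normal law\<close>

lemma emeasure_std_normal_ge:
  assumes "0 \<le> t"
  shows "emeasure std_normal {t..} \<le> ennreal (exp (- t\<^sup>2 / 2))"
proof -
  have "emeasure std_normal {t..} = (\<integral>\<^sup>+x. ennreal (std_normal_density x) * indicator {t..} x \<partial>lborel)"
    by (simp add: std_normal_def emeasure_density)
  \<comment> \<open>Since x^2 = t^2 + (x - t)^2 + 2 t (x - t), dropping the last, nonnegative term
    bounds the density by exp (- t^2 / 2) times the density shifted by t.\<close>
  also have "\<dots> \<le> (\<integral>\<^sup>+x. ennreal (exp (- t\<^sup>2 / 2)) * ennreal (std_normal_density (- t + 1 * x)) \<partial>lborel)"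
  proof (intro nn_integral_mono)
    fix x
    show "ennreal (std_normal_density x) * indicator {t..} x
        \<le> ennreal (exp (- t\<^sup>2 / 2)) * ennreal (std_normal_density (- t + 1 * x))"
    proof (cases "t \<le> x")
      case True
      have "0 \<le> t * (x - t)" using True assms by simp
      then have "exp (- x\<^sup>2 / 2) \<le> exp (- t\<^sup>2 / 2 + - (x - t)\<^sup>2 / 2)"
        by (simp add: power2_eq_square algebra_simps)
      then have "std_normal_density x \<le> exp (- t\<^sup>2 / 2) * std_normal_density (- t + 1 * x)"
        unfolding std_normal_density_def exp_add by (simp add: divide_right_mono)
      then show ?thesis using True by (simp add: ennreal_mult [symmetric])
    qed simp
  qed
  also have "\<dots> = ennreal (exp (- t\<^sup>2 / 2)) * (\<integral>\<^sup>+x. ennreal (std_normal_density (- t + 1 * x)) \<partial>lborel)"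
    by (rule nn_integral_cmult) simp
  also have "(\<integral>\<^sup>+x. ennreal (std_normal_density (- t + 1 * x)) \<partial>lborel) = (\<integral>\<^sup>+x. ennreal (std_normal_density x) \<partial>lborel)"
    using nn_integral_real_affine [of "\<lambda>x. ennreal (std_normal_density x)" 1 "- t"] by simp
  also have "\<dots> = emeasure std_normal UNIV"
    by (simp add: std_normal_def emeasure_density)
  also have "\<dots> = 1" using prob_space.emeasure_space_1 [OF prob_space_std_normal] by simp
  finally show ?thesis by simp
qed

text \<open>On [t, t + 1] the density is at least its value at t + 1. Passing from t to t + 1 costs
  a factor exp (- t - 1/2), which is subpolynomial when t is of order sqrt (log p).\<close>

lemma emeasure_std_normal_le:
  assumes "0 \<le> t"
  shows "ennreal (exp (- (t + 1)\<^sup>2 / 2) / sqrt (2 * pi)) \<le> emeasure std_normal {t..}"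
proof -
  have "ennreal (exp (- (t + 1)\<^sup>2 / 2) / sqrt (2 * pi))
      = (\<integral>\<^sup>+x. ennreal (exp (- (t + 1)\<^sup>2 / 2) / sqrt (2 * pi)) * indicator {t..t+1} x \<partial>lborel)"
    by (simp add: nn_integral_cmult_indicator)
  also have "\<dots> \<le> (\<integral>\<^sup>+x. ennreal (std_normal_density x) * indicator {t..} x \<partial>lborel)"
  proof (intro nn_integral_mono)
    fix x
    show "ennreal (exp (- (t + 1)\<^sup>2 / 2) / sqrt (2 * pi)) * indicator {t..t+1} x
        \<le> ennreal (std_normal_density x) * indicator {t..} x"
    proof (cases "x \<in> {t..t+1}")
      case True
      then have "x\<^sup>2 \<le> (t + 1)\<^sup>2" using assms by (intro power_mono) auto
      then have "exp (- (t + 1)\<^sup>2 / 2) / sqrt (2 * pi) \<le> std_normal_density x"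
        by (simp add: std_normal_density_def divide_right_mono)
      then show ?thesis using True by (auto intro: ennreal_leI)
    qed simp
  qed
  also have "\<dots> = emeasure std_normal {t..}"
    by (simp add: std_normal_def emeasure_density)
  finally show ?thesis .
qed

lemma
  assumes M: "prob_space M" and Z: "distributed M lborel Z (normal_density 0 \<sigma>)"
    and \<sigma>: "0 < \<sigma>" and t: "0 \<le> t"
  shows normal_tail_le: "measure M {\<omega>\<in>space M. t * \<sigma> \<le> Z \<omega>} \<le> exp (- t\<^sup>2 / 2)"
    and normal_tail_ge: "exp (- (t + 1)\<^sup>2 / 2) / sqrt (2 * pi) \<le> measure M {\<omega>\<in>space M. t * \<sigma> \<le> Z \<omega>}"
proof -
  interpret prob_space M by fact
  have d: "distributed M lborel (\<lambda>\<omega>. (Z \<omega> - 0) / \<sigma>) std_normal_density"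
    using normal_standard_normal_convert [OF \<sigma>] Z by blast
  have "emeasure M {\<omega>\<in>space M. t * \<sigma> \<le> Z \<omega>} = emeasure M ((\<lambda>\<omega>. (Z \<omega> - 0) / \<sigma>) -` {t..} \<inter> space M)"
    using \<sigma> by (intro arg_cong2 [where f = emeasure]) (auto simp: field_simps)
  also have "\<dots> = emeasure std_normal {t..}"
    by (subst distributed_emeasure [OF d]) (auto simp: std_normal_def emeasure_density)
  finally have e: "ennreal (measure M {\<omega>\<in>space M. t * \<sigma> \<le> Z \<omega>}) = emeasure std_normal {t..}"
    by (simp add: emeasure_eq_measure)
  show "measure M {\<omega>\<in>space M. t * \<sigma> \<le> Z \<omega>} \<le> exp (- t\<^sup>2 / 2)"
    using emeasure_std_normal_ge [OF t] unfolding e [symmetric] by simp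
  show "exp (- (t + 1)\<^sup>2 / 2) / sqrt (2 * pi) \<le> measure M {\<omega>\<in>space M. t * \<sigma> \<le> Z \<omega>}"
    using emeasure_std_normal_le [OF t] unfolding e [symmetric] by simp
qed

section \<open>Half-planes under a correlated Gaussian pair\<close>

text \<open>The variance of a G1 + b G2 for standard normal G1 and G2 with correlation rho.\<close>

definition covq :: "real \<Rightarrow> real \<Rightarrow> real \<Rightarrow> real" where
  "covq \<rho> a b = a\<^sup>2 + b\<^sup>2 + 2 * \<rho> * a * b"

lemma covq_pos:
  assumes "\<bar>\<rho>\<bar> < 1" "a \<noteq> 0 \<or> b \<noteq> 0"
  shows "0 < covq \<rho> a b"
proof -
  have r: "0 < 1 - \<rho>\<^sup>2" using assms(1) by (simp add: abs_square_less_1)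
  have e: "covq \<rho> a b = (a + \<rho> * b)\<^sup>2 + (1 - \<rho>\<^sup>2) * b\<^sup>2"
    by (simp add: covq_def power2_eq_square algebra_simps)
  show ?thesis
  proof (cases "b = 0")
    case True
    then show ?thesis using assms by (simp add: covq_def)
  next
    case False
    then have "0 < (1 - \<rho>\<^sup>2) * b\<^sup>2" using r by simp
    then show ?thesis unfolding e by (simp add: add_nonneg_pos)
  qed
qed

text \<open>Only one-dimensional marginals are recorded: probabilities of half-planes suffice for the
  exponential rates of all planar events below, so no bivariate density is needed.\<close>

definition gauss_pair :: "real \<Rightarrow> 'a measure \<Rightarrow> ('a \<Rightarrow> real) \<Rightarrow> ('a \<Rightarrow> real) \<Rightarrow> bool" where
  "gauss_pair \<rho> M G1 G2 \<longleftrightarrow> prob_space M \<and> G1 \<in> borel_measurable M \<and> G2 \<in> borel_measurable M \<and>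
     (\<forall>a b. 0 < covq \<rho> a b \<longrightarrow>
        distributed M lborel (\<lambda>\<omega>. a * G1 \<omega> + b * G2 \<omega>) (normal_density 0 (sqrt (covq \<rho> a b))))"

lemma gauss_pair_uminus1: "gauss_pair \<rho> M G1 G2 \<Longrightarrow> gauss_pair (- \<rho>) M (\<lambda>\<omega>. - G1 \<omega>) G2"
  unfolding gauss_pair_def
proof (elim conjE, intro conjI allI impI)
  fix a b assume *: "\<forall>a b. 0 < covq \<rho> a b \<longrightarrow>
        distributed M lborel (\<lambda>\<omega>. a * G1 \<omega> + b * G2 \<omega>) (normal_density 0 (sqrt (covq \<rho> a b)))"
    "0 < covq (- \<rho>) a b"
  have "covq \<rho> (- a) b = covq (- \<rho>) a b" by (simp add: covq_def)
  with *(1) [rule_format, of "- a" b] *(2)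
  show "distributed M lborel (\<lambda>\<omega>. a * - G1 \<omega> + b * G2 \<omega>) (normal_density 0 (sqrt (covq (- \<rho>) a b)))"
    by simp
qed auto

lemma gauss_pair_commute: "gauss_pair \<rho> M G1 G2 \<Longrightarrow> gauss_pair \<rho> M G2 G1"
  unfolding gauss_pair_def
proof (elim conjE, intro conjI allI impI)
  fix a b assume *: "\<forall>a b. 0 < covq \<rho> a b \<longrightarrow>
        distributed M lborel (\<lambda>\<omega>. a * G1 \<omega> + b * G2 \<omega>) (normal_density 0 (sqrt (covq \<rho> a b)))"
    "0 < covq \<rho> a b"
  have "covq \<rho> b a = covq \<rho> a b" by (simp add: covq_def)
  with *(1) [rule_format, of b a] *(2)
  show "distributed M lborel (\<lambda>\<omega>. a * G2 \<omega> + b * G1 \<omega>) (normal_density 0 (sqrt (covq \<rho> a b)))"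
    by (simp add: add.commute)
qed auto

lemma gauss_pair_uminus2: "gauss_pair \<rho> M G1 G2 \<Longrightarrow> gauss_pair (- \<rho>) M G1 (\<lambda>\<omega>. - G2 \<omega>)"
  using gauss_pair_uminus1 gauss_pair_commute by blast

text \<open>The unit in which a Gaussian tail at x has order p^(-x^2): with s this scale, exp (- (x
  s)^2 / 2) = p^(-x^2).\<close>

definition logscale :: "nat \<Rightarrow> real" where
  "logscale p = sqrt (2 * ln (real p))"

lemma logscale_pos: "2 \<le> p \<Longrightarrow> 0 < logscale p"
  by (simp add: logscale_def)

lemma logscale_sq: "1 \<le> p \<Longrightarrow> (logscale p)\<^sup>2 = 2 * ln (real p)"
  by (simp add: logscale_def)

lemma exp_logscale: "1 \<le> p \<Longrightarrow> exp (- (x * (logscale p)\<^sup>2 / 2)) = real p powr (- x)"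
  by (simp add: logscale_sq powr_def)

text \<open>The positive part takes care of half-planes that contain the centre, for which the bound
  is the trivial 1.\<close>

lemma halfplane_le:
  assumes G: "gauss_pair \<rho> M G1 G2" and v: "covq \<rho> a b = v" "0 < v" and p: "2 \<le> p"
  shows "measure M {\<omega>\<in>space M. T * logscale p \<le> a * G1 \<omega> + b * G2 \<omega>} \<le> real p powr (- ((pospart T)\<^sup>2 / v))"
proof -
  interpret prob_space M using G by (simp add: gauss_pair_def)
  have d: "distributed M lborel (\<lambda>\<omega>. a * G1 \<omega> + b * G2 \<omega>) (normal_density 0 (sqrt v))"
    using G v(2) unfolding v(1) [symmetric] gauss_pair_def by blast
  show ?thesis
  proof (cases "0 \<le> T")
    case True
    define t where "t = T * logscale p / sqrt v"
    have "0 \<le> t" using True v logscale_pos [OF p] by (simp add: t_def)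
    have "T * logscale p = t * sqrt v" using v by (simp add: t_def)
    then have "measure M {\<omega>\<in>space M. T * logscale p \<le> a * G1 \<omega> + b * G2 \<omega>} \<le> exp (- t\<^sup>2 / 2)"
      using normal_tail_le [OF prob_space_axioms d _ \<open>0 \<le> t\<close>] v by simp
    also have "t\<^sup>2 = T\<^sup>2 / v * (logscale p)\<^sup>2" using v by (simp add: t_def power_mult_distrib power_divide)
    finally show ?thesis using exp_logscale [of p "T\<^sup>2 / v"] p True by (simp add: pospart_def)
  next
    case False
    then show ?thesis using p by (simp add: pospart_def)
  qed
qed

lemma halfplane_ge:
  assumes G: "gauss_pair \<rho> M G1 G2" and v: "covq \<rho> a b = v" "0 < v" and p: "2 \<le> p" and T: "0 \<le> T"
  shows "exp (- (T / sqrt v * logscale p + 1)\<^sup>2 / 2) / sqrt (2 * pi)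
    \<le> measure M {\<omega>\<in>space M. T * logscale p \<le> a * G1 \<omega> + b * G2 \<omega>}"
proof -
  have d: "distributed M lborel (\<lambda>\<omega>. a * G1 \<omega> + b * G2 \<omega>) (normal_density 0 (sqrt v))"
    and M: "prob_space M" using G v(2) unfolding v(1) [symmetric] gauss_pair_def by blast+
  define t where "t = T / sqrt v * logscale p"
  have "0 \<le> t" using T v logscale_pos [OF p] by (simp add: t_def)
  have eq: "T * logscale p = t * sqrt v" using v by (simp add: t_def)
  show ?thesis
    unfolding eq t_def [symmetric] using normal_tail_ge [OF M d _ \<open>0 \<le> t\<close>] v by simp
qed

section \<open>Lower bounds near a point of the plane\<close>

text \<open>The squared Mahalanobis length x^T S^(-1) x for the covariance matrix S = ((1, rho),
  (rho, 1)): \<open>dist2\<close> is the quadratic form of the adjugate of S, and 1 - rho^2 is the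
  determinant.\<close>

definition rate :: "real \<Rightarrow> real \<times> real \<Rightarrow> real" where
  "rate \<rho> x = dist2 \<rho> x (0, 0) / (1 - \<rho>\<^sup>2)"

text \<open>The half-plane \<open>E0\<close> has x as its nearest point to the origin, so its order
  is p to the minus \<open>rate\<close>. Outside the box it is covered by a translate of itself
  (\<open>E1\<close>) and by two half-planes tilted either way (\<open>E2\<close>,
  \<open>E3\<close>), all strictly farther from the origin, so the box keeps the order of
  \<open>E0\<close>.\<close>

lemma gauss_pair_box_ge:
  assumes rho: "\<bar>\<rho>\<bar> < 1" and x: "(x1, x2) \<noteq> (0, 0)" and "0 < \<delta>" "0 < e"
  shows "\<forall>\<^sub>F p in sequentially. \<forall>(M :: 'a measure) G1 G2. gauss_pair \<rho> M G1 G2 \<longrightarrow>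
    real p powr (- (rate \<rho> (x1, x2) + e)) \<le>
    measure M {\<omega>\<in>space M. \<bar>G1 \<omega> / logscale p - x1\<bar> \<le> \<delta> \<and> \<bar>G2 \<omega> / logscale p - x2\<bar> \<le> \<delta>}"
proof -
  define U where "U = covq (- \<rho>) x1 x2"
  define c where "c = 1 - \<rho>\<^sup>2"
  \<comment> \<open>The vector t is (1 - rho^2) S^(-1) x, the normal of \<open>E0\<close>; U is its
    inner product with x.\<close>
  define t1 t2 where "t1 = x1 - \<rho> * x2" and "t2 = x2 - \<rho> * x1"
  have c: "0 < c" using rho by (simp add: c_def abs_square_less_1)
  have U: "0 < U" unfolding U_def using rho x by (intro covq_pos) auto
  have rate: "rate \<rho> (x1, x2) = U / c"
    by (simp add: rate_def dist2_def U_def covq_def c_def)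
  define K where "K = \<bar>x1\<bar> + \<bar>x2\<bar> + \<bar>t1\<bar> + \<bar>t2\<bar>"
  have "0 \<le> K" by (simp add: K_def)
  \<comment> \<open>Small enough that displacements of size at most d in the coordinates
    \<open>th\<close> and \<open>uh\<close> below stay inside the box; K bounds the coefficients of
    that change of coordinates.\<close>
  define d where "d = \<delta> * U / (K + 1)"
  have d: "0 < d" using \<open>0 < \<delta>\<close> U \<open>0 \<le> K\<close> by (simp add: d_def)
  have dK: "d * K \<le> \<delta> * U" 
    using \<open>0 < \<delta>\<close> U \<open>0 \<le> K\<close> by (simp add: d_def field_simps)
  \<comment> \<open>The tilted normals are t plus or minus kappa (- x2, x1). The Gaussian in that
    direction is uncorrelated with the one along t, so the variances add. This kappa maximises D2,
    with value U / c + d^2 / U.\<close>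
  define \<kappa> where "\<kappa> = c * d / U"
  have \<kappa>: "0 < \<kappa>" using c d U by (simp add: \<kappa>_def)
  define v where "v = c * U + \<kappa>\<^sup>2 * U"
  have v: "0 < v" unfolding v_def using c U by (intro add_pos_nonneg) auto
  have cov0: "covq \<rho> t1 t2 = c * U"
    by (simp add: covq_def t1_def t2_def U_def c_def power2_eq_square algebra_simps)
  have cov1: "covq \<rho> (t1 - \<kappa> * x2) (t2 + \<kappa> * x1) = v"
    by (simp add: covq_def t1_def t2_def U_def c_def v_def power2_eq_square algebra_simps)
  have cov2: "covq \<rho> (t1 + \<kappa> * x2) (t2 - \<kappa> * x1) = v"
    by (simp add: covq_def t1_def t2_def U_def c_def v_def power2_eq_square algebra_simps)
  define D1 D2 where "D1 = (U + d)\<^sup>2 / (c * U)" and "D2 = (U + \<kappa> * d)\<^sup>2 / v"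
  have "U\<^sup>2 < (U + d)\<^sup>2" using U d by (intro power_strict_mono) auto
  then have D1: "U / c < D1" using U c by (simp add: D1_def field_simps power2_eq_square)
  have D2: "U / c < D2"
  proof -
    have eq: "U\<^sup>2 * \<kappa>\<^sup>2 = c * (U * \<kappa> * d)" using U by (simp add: \<kappa>_def power2_eq_square field_simps)
    have pos: "0 < U * \<kappa> * d" using U \<kappa> d by simp
    have "U\<^sup>2 * \<kappa>\<^sup>2 < c * (2 * (U * \<kappa> * d) + (\<kappa> * d)\<^sup>2)"
    proof -
      have "0 < c * (U * \<kappa> * d)" "0 \<le> c * (\<kappa> * d)\<^sup>2" using c pos by simp_all
      then show ?thesis using eq unfolding distrib_left by linarith
    qed
    then have "U * v < c * (U + \<kappa> * d)\<^sup>2"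
      by (simp add: v_def power2_eq_square algebra_simps)
    then show ?thesis using c v by (simp add: D2_def field_simps)
  qed
  define a where "a = sqrt (U / c)"
  have a: "0 < a" "a\<^sup>2 = U / c" using U c by (simp_all add: a_def)
  \<comment> \<open>The excess cost of the removed half-planes, capped by e: each of them has
    probability at most p^(-(a^2 + e')).\<close>
  define e' where "e' = min e (min (D1 - U / c) (D2 - U / c))"
  have e': "0 < e'" using \<open>0 < e\<close> D1 D2 by (simp add: e'_def)
  \<comment> \<open>Expanding the square leaves a loss a sqrt (2 log p) + 1/2 in the exponent, which
    e' log p eventually beats. Of the factor 4, three units pay for the removed half-planes and one
    remains.\<close>
  have "\<forall>\<^sub>F p in sequentially. 4 * real p powr (- (a\<^sup>2 + e')) \<le> exp (- (a * sqrt (2 * ln (real p)) + 1)\<^sup>2 / 2) / sqrt (2 * pi)"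
  proof -
    have "filterlim (\<lambda>p. e' * ln (real p) - a * sqrt (2 * ln (real p)) - 1 / 2) at_top sequentially"
      using a e' by real_asymp
    then have "\<forall>\<^sub>F p in sequentially. ln (4 * sqrt (2 * pi)) \<le> e' * ln (real p) - a * sqrt (2 * ln (real p)) - 1 / 2"
      by (simp add: filterlim_at_top)
    moreover have "\<forall>\<^sub>F p in sequentially. (1::nat) \<le> p" by (rule eventually_ge_at_top)
    ultimately show ?thesis
    proof eventually_elim
      case (elim p)
      have "4 * sqrt (2 * pi) = exp (ln (4 * sqrt (2 * pi)))" by simp
      also have "\<dots> \<le> exp (e' * ln (real p) - a * sqrt (2 * ln (real p)) - 1 / 2)"
        using elim(1) by (simp only: exp_le_cancel_iff)
      finally have "4 * sqrt (2 * pi) * exp (- (a\<^sup>2 + e') * ln (real p))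
         \<le> exp (e' * ln (real p) - a * sqrt (2 * ln (real p)) - 1 / 2) * exp (- (a\<^sup>2 + e') * ln (real p))"
        by (intro mult_right_mono) auto
      also have "\<dots> = exp (- (a * sqrt (2 * ln (real p)) + 1)\<^sup>2 / 2)"
        unfolding exp_add [symmetric] using elim(2)
        by (simp add: power2_sum power_mult_distrib algebra_simps)
      finally show ?case using elim(2) by (simp add: powr_def field_simps)
    qed
  qed
  moreover have "\<forall>\<^sub>F p in sequentially. (2::nat) \<le> p" by (rule eventually_ge_at_top)
  ultimately show ?thesis
  proof eventually_elim
    case (elim p)
    show ?case
    proof (intro allI impI)
      fix M :: "'a measure" and G1 G2
      assume G: "gauss_pair \<rho> M G1 G2"
      interpret prob_space M using G by (simp add: gauss_pair_def)
      have [measurable]: "G1 \<in> borel_measurable M" "G2 \<in> borel_measurable M"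
        using G by (simp_all add: gauss_pair_def)
      define s where "s = logscale p"
      have s: "0 < s" using elim by (simp add: s_def logscale_pos)
      let ?P = "real p powr (- (a\<^sup>2 + e'))"
      have P: "real p powr (- y) \<le> ?P" if "a\<^sup>2 + e' \<le> y" for y
        using that elim by (intro powr_mono) auto
      define B where "B = {\<omega>\<in>space M. \<bar>G1 \<omega> / s - x1\<bar> \<le> \<delta> \<and> \<bar>G2 \<omega> / s - x2\<bar> \<le> \<delta>}"
      define E0 where "E0 = {\<omega>\<in>space M. U * s \<le> t1 * G1 \<omega> + t2 * G2 \<omega>}"
      define E1 where "E1 = {\<omega>\<in>space M. (U + d) * s \<le> t1 * G1 \<omega> + t2 * G2 \<omega>}"
      define E2 where "E2 = {\<omega>\<in>space M. (U + \<kappa> * d) * s \<le> (t1 - \<kappa> * x2) * G1 \<omega> + (t2 + \<kappa> * x1) * G2 \<omega>}"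
      define E3 where "E3 = {\<omega>\<in>space M. (U + \<kappa> * d) * s \<le> (t1 + \<kappa> * x2) * G1 \<omega> + (t2 - \<kappa> * x1) * G2 \<omega>}"
      have [measurable]: "B \<in> sets M" "E0 \<in> sets M" "E1 \<in> sets M" "E2 \<in> sets M" "E3 \<in> sets M"
        unfolding B_def E0_def E1_def E2_def E3_def by measurable
      have "U / sqrt (c * U) = a" 
        using U c by (simp add: a_def real_sqrt_mult real_sqrt_divide field_simps flip: power2_eq_square)
      then have "exp (- (a * s + 1)\<^sup>2 / 2) / sqrt (2 * pi) \<le> prob E0"
        using halfplane_ge [OF G cov0, of p U] U c elim by (simp add: E0_def s_def)
      then have p0: "4 * ?P \<le> prob E0"
        using elim(1) by (simp add: s_def logscale_def)
      have p1: "prob E1 \<le> ?P"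
      proof -
        have "prob E1 \<le> real p powr (- D1)"
          using halfplane_le [OF G cov0, of p "U + d"] U c d elim by (simp add: E1_def s_def pospart_def D1_def)
        also have "\<dots> \<le> ?P" by (rule P) (simp add: a e'_def)
        finally show ?thesis .
      qed
      have T: "pospart (U + \<kappa> * d) = U + \<kappa> * d" using U \<kappa> d by (simp add: pospart_def add_nonneg_nonneg)
      have P2: "real p powr (- D2) \<le> ?P" by (rule P) (simp add: a e'_def)
      have "prob E2 \<le> real p powr (- D2)" "prob E3 \<le> real p powr (- D2)"
        using halfplane_le [OF G cov1 v elim(2), of "U + \<kappa> * d"]
          halfplane_le [OF G cov2 v elim(2), of "U + \<kappa> * d"]
        unfolding T by (simp_all add: E2_def E3_def s_def D2_def)
      then have p2: "prob E2 \<le> ?P" and p3: "prob E3 \<le> ?P" using P2 by linarith+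
      have "E0 \<subseteq> B \<union> (E1 \<union> (E2 \<union> E3))"
      proof
        fix \<omega> assume \<omega>: "\<omega> \<in> E0"
        define h1 h2 where "h1 = G1 \<omega> / s - x1" and "h2 = G2 \<omega> / s - x2"
        have g: "G1 \<omega> = (x1 + h1) * s" "G2 \<omega> = (x2 + h2) * s" using s by (simp_all add: h1_def h2_def)
        have Ux: "U = t1 * x1 + t2 * x2"
          by (simp add: U_def covq_def t1_def t2_def power2_eq_square algebra_simps)
        \<comment> \<open>Coordinates of the displacement h from x: along the normal t and along (-
          x2, x1). Membership in \<open>E0\<close> means th >= 0, avoiding \<open>E1\<close> gives
          th < d, and avoiding \<open>E2\<close> and \<open>E3\<close> bounds |uh| by d.\<close>
        define th uh where "th = t1 * h1 + t2 * h2" and "uh = x1 * h2 - x2 * h1"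
        have lin: "t1 * G1 \<omega> + t2 * G2 \<omega> = (U + th) * s"
          "(t1 - \<kappa> * x2) * G1 \<omega> + (t2 + \<kappa> * x1) * G2 \<omega> = (U + th + \<kappa> * uh) * s"
          "(t1 + \<kappa> * x2) * G1 \<omega> + (t2 - \<kappa> * x1) * G2 \<omega> = (U + th - \<kappa> * uh) * s"
          unfolding g th_def uh_def Ux by (simp_all add: algebra_simps)
        have sp: "\<omega> \<in> space M" using \<omega> by (simp add: E0_def)
        have th0: "0 \<le> th" using \<omega> s by (simp add: E0_def lin)
        show "\<omega> \<in> B \<union> (E1 \<union> (E2 \<union> E3))"
        proof (rule ccontr)
          assume n: "\<omega> \<notin> B \<union> (E1 \<union> (E2 \<union> E3))"
          have th1: "th < d" using n s sp by (simp add: E1_def lin)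
          have "\<not> d \<le> uh"
          proof
            assume "d \<le> uh"
            then have "\<kappa> * d \<le> \<kappa> * uh" using \<kappa> by simp
            then have "U + \<kappa> * d \<le> U + th + \<kappa> * uh" using th0 by simp
            then show False using n s sp by (simp add: E2_def lin)
          qed
          moreover have "\<not> d \<le> - uh"
          proof
            assume "d \<le> - uh"
            then have "\<kappa> * d \<le> \<kappa> * - uh" using \<kappa> by (intro mult_left_mono) auto
            then have "U + \<kappa> * d \<le> U + th - \<kappa> * uh" using th0 by simp
            then show False using n s sp by (simp add: E3_def lin)
          qed
          ultimately have uh: "\<bar>uh\<bar> \<le> d" by linarith
          have h: "U * h1 = th * x1 + uh * - t2" "U * h2 = th * x2 + uh * t1"
            by (simp_all add: U_def covq_def th_def uh_def t1_def t2_def power2_eq_square algebra_simps)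
          have bound: "\<bar>th * y + uh * z\<bar> \<le> \<delta> * U" if "\<bar>y\<bar> + \<bar>z\<bar> \<le> K" for y z
          proof -
            have "\<bar>th * y + uh * z\<bar> \<le> \<bar>th\<bar> * \<bar>y\<bar> + \<bar>uh\<bar> * \<bar>z\<bar>"
              using abs_triangle_ineq [of "th * y" "uh * z"] by (simp only: abs_mult)
            also have "\<dots> \<le> d * \<bar>y\<bar> + d * \<bar>z\<bar>"
              using th0 th1 uh by (intro add_mono mult_right_mono) auto
            also have "\<dots> \<le> d * K" using that d by (simp add: distrib_left [symmetric])
            finally show ?thesis using dK by linarith
          qed
          have "U * \<bar>h1\<bar> \<le> \<delta> * U" "U * \<bar>h2\<bar> \<le> \<delta> * U"
            using bound [of x1 "- t2"] bound [of x2 t1] U unfolding h [symmetric] abs_mult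
            by (simp_all add: K_def)
          then have "\<omega> \<in> B" using U sp by (simp add: B_def h1_def h2_def mult.commute)
          then show False using n by simp
        qed
      qed
      then have "prob E0 \<le> prob (B \<union> (E1 \<union> (E2 \<union> E3)))" by (intro finite_measure_mono) auto
      also have "\<dots> \<le> prob B + (prob E1 + (prob E2 + prob E3))"
        by (intro order_trans [OF measure_Un_le] add_left_mono) auto
      finally have "?P \<le> prob B" using p0 p1 p2 p3 by linarith
      moreover have "real p powr (- (U / c + e)) \<le> ?P" by (intro P) (simp add: a e'_def)
      ultimately show "real p powr (- (rate \<rho> (x1, x2) + e)) \<le>
          prob {\<omega>\<in>space M. \<bar>G1 \<omega> / logscale p - x1\<bar> \<le> \<delta> \<and> \<bar>G2 \<omega> / logscale p - x2\<bar> \<le> \<delta>}"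
        unfolding rate B_def s_def by linarith
    qed
  qed
qed

text \<open>By continuity of \<open>rate\<close>, some point w of the open set near z costs less
  than e / 2 more, and a small box around w lies inside the set.\<close>

lemma gauss_pair_open_ge:
  fixes O' :: "(real \<times> real) set" and z c :: "real \<times> real"
  assumes rho: "\<bar>\<rho>\<bar> < 1" and O: "open O'" and z: "z \<in> closure O'" and e: "0 < e"
  shows "\<forall>\<^sub>F p in sequentially. \<forall>(M :: 'a measure) G1 G2. gauss_pair \<rho> M G1 G2 \<longrightarrow>
    real p powr (- (rate \<rho> (z - c) + e)) \<le>
    measure M {\<omega>\<in>space M. (fst c + G1 \<omega> / logscale p, snd c + G2 \<omega> / logscale p) \<in> O'}"
proof -
  define V where "V = {w. rate \<rho> (w - c) < rate \<rho> (z - c) + e / 2}"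
  have "open V" unfolding V_def rate_def dist2_def
    by (intro open_Collect_less continuous_intros)
       (use rho abs_square_less_1 [of \<rho>] in auto)
  moreover have "z \<in> V" using e by (simp add: V_def)
  ultimately have "V \<inter> O' \<noteq> {}" using z open_Int_closure_eq_empty [of V O'] by auto
  moreover have "open (V \<inter> O')" using O \<open>open V\<close> by blast
  ultimately have "\<not> V \<inter> O' \<subseteq> {c}" 
    using not_open_singleton [of c] by (auto dest: subset_singletonD)
  then obtain w where w: "w \<in> V" "w \<in> O'" "w \<noteq> c" by blast
  obtain \<epsilon> where \<epsilon>: "0 < \<epsilon>" "ball w \<epsilon> \<subseteq> O'" using O w(2) by (meson open_contains_ball)
  define x1 x2 where "x1 = fst w - fst c" and "x2 = snd w - snd c"
  have x: "w - c = (x1, x2)" "(x1, x2) \<noteq> (0, 0)"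
    using w(3) by (auto simp: x1_def x2_def prod_eq_iff)
  have "\<forall>\<^sub>F p in sequentially. \<forall>(M :: 'a measure) G1 G2. gauss_pair \<rho> M G1 G2 \<longrightarrow>
    real p powr (- (rate \<rho> (x1, x2) + e / 2)) \<le>
    measure M {\<omega>\<in>space M. \<bar>G1 \<omega> / logscale p - x1\<bar> \<le> \<epsilon> / 3 \<and> \<bar>G2 \<omega> / logscale p - x2\<bar> \<le> \<epsilon> / 3}"
    using rho x(2) \<epsilon>(1) e by (intro gauss_pair_box_ge) auto
  moreover have "\<forall>\<^sub>F p in sequentially. (2::nat) \<le> p" by (rule eventually_ge_at_top)
  ultimately show ?thesis
  proof eventually_elim
    case (elim p)
    show ?case
    proof (intro allI impI)
      fix M :: "'a measure" and G1 G2
      assume G: "gauss_pair \<rho> M G1 G2"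
      interpret prob_space M using G by (simp add: gauss_pair_def)
      have [measurable]: "G1 \<in> borel_measurable M" "G2 \<in> borel_measurable M"
        using G by (simp_all add: gauss_pair_def)
      have [measurable]: "O' \<in> sets (borel \<Otimes>\<^sub>M borel)" using O unfolding borel_prod by (rule borel_open)
      have "real p powr (- (rate \<rho> (z - c) + e)) \<le> real p powr (- (rate \<rho> (x1, x2) + e / 2))"
        using w(1) elim(2) unfolding V_def x(1) [symmetric] by (intro powr_mono) auto
      also have "\<dots> \<le> prob {\<omega>\<in>space M. \<bar>G1 \<omega> / logscale p - x1\<bar> \<le> \<epsilon> / 3 \<and> \<bar>G2 \<omega> / logscale p - x2\<bar> \<le> \<epsilon> / 3}"
        using elim(1) G by blast
      also have "\<dots> \<le> prob {\<omega>\<in>space M. (fst c + G1 \<omega> / logscale p, snd c + G2 \<omega> / logscale p) \<in> O'}"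
      proof (intro finite_measure_mono subsetI)
        fix \<omega> assume "\<omega> \<in> {\<omega>\<in>space M. \<bar>G1 \<omega> / logscale p - x1\<bar> \<le> \<epsilon> / 3 \<and> \<bar>G2 \<omega> / logscale p - x2\<bar> \<le> \<epsilon> / 3}"
        then have \<omega>: "\<omega> \<in> space M" "\<bar>G1 \<omega> / logscale p - x1\<bar> \<le> \<epsilon> / 3" "\<bar>G2 \<omega> / logscale p - x2\<bar> \<le> \<epsilon> / 3" by auto
        have "dist w (fst c + G1 \<omega> / logscale p, snd c + G2 \<omega> / logscale p)
            \<le> \<bar>G1 \<omega> / logscale p - x1\<bar> + \<bar>G2 \<omega> / logscale p - x2\<bar>"
          unfolding dist_prod_def
          by (rule order_trans [OF sqrt_sum_squares_le_sum_abs])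
             (simp add: dist_real_def x1_def x2_def abs_minus_commute algebra_simps)
        also have "\<dots> < \<epsilon>" using \<omega> \<epsilon>(1) by linarith
        finally show "\<omega> \<in> {\<omega>\<in>space M. (fst c + G1 \<omega> / logscale p, snd c + G2 \<omega> / logscale p) \<in> O'}"
          using \<epsilon>(2) \<omega>(1) by auto
      qed measurable
      finally show "real p powr (- (rate \<rho> (z - c) + e)) \<le>
        prob {\<omega>\<in>space M. (fst c + G1 \<omega> / logscale p, snd c + G2 \<omega> / logscale p) \<in> O'}" .
    qed
  qed
qed

section \<open>The zero region of one coordinate and its rates\<close>

definition rescaled :: "real \<times> real \<Rightarrow> ('a \<Rightarrow> real) \<Rightarrow> ('a \<Rightarrow> real) \<Rightarrow> nat \<Rightarrow> 'a \<Rightarrow> real \<times> real" where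
  "rescaled c G1 G2 p \<omega> = (fst c + G1 \<omega> / logscale p, snd c + G2 \<omega> / logscale p)"

definition dead :: "real \<Rightarrow> real \<Rightarrow> (real \<times> real) set" where
  "dead \<eta> Q = {x. \<bar>fst x - \<eta> * soft Q (snd x)\<bar> \<le> Q}"

lemma continuous_on_soft [continuous_intros]:
  "continuous_on A f \<Longrightarrow> continuous_on A (\<lambda>x. soft l (f x))"
  unfolding soft_def by (intro continuous_intros)

lemma closed_dead: "closed (dead \<eta> Q)"
  unfolding dead_def by (intro closed_Collect_le continuous_intros)

lemma measurable_rescaled [measurable]:
  assumes [measurable]: "G1 \<in> borel_measurable M" "G2 \<in> borel_measurable M"
  shows "rescaled c G1 G2 p \<in> borel_measurable M"
  unfolding rescaled_def by measurable

lemma soft_uminus: "0 \<le> l \<Longrightarrow> soft l (- x) = - soft l x"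
  by (auto simp: soft_def max_def min_def)

lemma dead_uminus_fst: "(- x1, x2) \<in> dead (- \<eta>) Q \<longleftrightarrow> (x1, x2) \<in> dead \<eta> Q"
  by (auto simp: dead_def abs_le_iff)

lemma dead_uminus_snd: "0 \<le> Q \<Longrightarrow> (x1, - x2) \<in> dead (- \<eta>) Q \<longleftrightarrow> (x1, x2) \<in> dead \<eta> Q"
  by (simp add: dead_def soft_uminus)

text \<open>A triple \<open>(a, b, T)\<close> encodes the half-plane \<open>T \<le> a x + b y\<close>.\<close>

definition hcost :: "real \<Rightarrow> real \<times> real \<Rightarrow> real \<times> real \<times> real \<Rightarrow> real" where
  "hcost \<rho> c h = (case h of (a, b, T) \<Rightarrow> (pospart (T - a * fst c - b * snd c))\<^sup>2 / covq \<rho> a b)"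

lemma gauss_pair_cover_le:
  assumes rho: "\<bar>\<rho>\<bar> < 1" and G: "gauss_pair \<rho> M G1 G2" and p: "2 \<le> p"
    and nz: "\<And>a b T. (a, b, T) \<in> set hs \<Longrightarrow> a \<noteq> 0 \<or> b \<noteq> 0"
    and cost: "\<And>h. h \<in> set hs \<Longrightarrow> k \<le> hcost \<rho> c h"
    and cover: "\<And>x1 x2. (x1, x2) \<in> E \<Longrightarrow> \<exists>(a, b, T)\<in>set hs. T \<le> a * x1 + b * x2"
  shows "measure M {\<omega>\<in>space M. rescaled c G1 G2 p \<omega> \<in> E} \<le> length hs * real p powr (- k)"
proof -
  interpret prob_space M using G by (simp add: gauss_pair_def)
  have [measurable]: "G1 \<in> borel_measurable M" "G2 \<in> borel_measurable M"
    using G by (simp_all add: gauss_pair_def)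
  define s where "s = logscale p"
  have s: "0 < s" using p by (simp add: s_def logscale_pos)
  define F where "F h = {\<omega>\<in>space M. case h of (a, b, T) \<Rightarrow> (T - a * fst c - b * snd c) * s \<le> a * G1 \<omega> + b * G2 \<omega>}" for h
  have Fm: "F h \<in> sets M" for h unfolding F_def by (cases h) simp
  have F: "prob (F h) \<le> real p powr (- k)" if h: "h \<in> set hs" for h
  proof -
    obtain a b T where abT: "h = (a, b, T)" by (cases h)
    have "prob (F h) \<le> real p powr (- hcost \<rho> c h)"
      using halfplane_le [OF G refl covq_pos [OF rho nz] p] h by (simp add: F_def abT hcost_def s_def)
    also have "\<dots> \<le> real p powr (- k)" using cost [OF h] p by (intro powr_mono) auto
    finally show ?thesis .
  qed
  have "{\<omega>\<in>space M. rescaled c G1 G2 p \<omega> \<in> E} \<subseteq> (\<Union>h\<in>set hs. F h)"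
  proof
    fix \<omega> assume \<omega>: "\<omega> \<in> {\<omega>\<in>space M. rescaled c G1 G2 p \<omega> \<in> E}"
    then obtain a b T where h: "(a, b, T) \<in> set hs"
      and le: "T \<le> a * (fst c + G1 \<omega> / s) + b * (snd c + G2 \<omega> / s)"
      using cover unfolding rescaled_def s_def [symmetric] by blast
    have "(T - a * fst c - b * snd c) * s \<le> (a * (G1 \<omega> / s) + b * (G2 \<omega> / s)) * s"
      using le s by (intro mult_right_mono) (auto simp: algebra_simps)
    also have "\<dots> = a * G1 \<omega> + b * G2 \<omega>" using s by (simp add: distrib_right)
    finally have "\<omega> \<in> F (a, b, T)" using \<omega> by (simp add: F_def)
    then show "\<omega> \<in> (\<Union>h\<in>set hs. F h)" using h by blast
  qed
  then have "prob {\<omega>\<in>space M. rescaled c G1 G2 p \<omega> \<in> E} \<le> prob (\<Union>h\<in>set hs. F h)"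
    by (intro finite_measure_mono sets.finite_UN Fm) auto
  also have "\<dots> \<le> (\<Sum>h\<in>set hs. prob (F h))"
    by (intro finite_measure_subadditive_finite) (auto simp: Fm)
  also have "\<dots> \<le> (\<Sum>h\<in>set hs. real p powr (- k))" by (intro sum_mono F)
  also have "\<dots> \<le> length hs * real p powr (- k)"
    by (simp add: card_length mult_right_mono)
  finally show ?thesis .
qed

text \<open>A nearest point of the active region usually lies on its boundary, which the open-set
  bound reaches only through the closure. Increasing the first coordinate enters the region.\<close>

lemma closure_active:
  assumes "Q \<le> fst z - \<eta> * soft Q (snd z)"
  shows "z \<in> closure (- dead \<eta> Q)"
  unfolding closure_approachable
proof (intro allI impI)
  fix e :: real assume "0 < e"
  then show "\<exists>y\<in>- dead \<eta> Q. dist y z < e"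
    using assms by (intro bexI [of _ "(fst z + e / 2, snd z)"]) (auto simp: dead_def dist_prod_def dist_real_def)
qed

lemma open_dead_interior: "open {x. \<bar>fst x - \<eta> * soft Q (snd x)\<bar> < Q}"
  by (intro open_Collect_less continuous_intros)

lemma closure_dead_interior:
  assumes "z \<in> dead \<eta> Q" "0 < Q"
  shows "z \<in> closure {x. \<bar>fst x - \<eta> * soft Q (snd x)\<bar> < Q}"
  unfolding closure_approachable
proof (intro allI impI)
  fix e :: real assume "0 < e"
  define u where "u = fst z - \<eta> * soft Q (snd z)"
  \<comment> \<open>The first coordinate is pulled towards the axis of the strip by m: e / 2 keeps
    the point close, and Q / 2 keeps it from reaching the opposite edge.\<close>
  define m where "m = min (e / 2) (Q / 2)"
  have m: "0 < m" "m < e" "m < Q" using \<open>0 < e\<close> \<open>0 < Q\<close> by (auto simp: m_def)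
  have u: "\<bar>u\<bar> \<le> Q" using assms by (simp add: dead_def u_def)
  have "\<bar>u - sgn u * m\<bar> < Q" using u m by (auto simp: sgn_if abs_if split: if_splits)
  then have "(fst z - sgn u * m, snd z) \<in> {x. \<bar>fst x - \<eta> * soft Q (snd x)\<bar> < Q}"
    by (simp add: u_def algebra_simps)
  moreover have "dist (fst z - sgn u * m, snd z) z < e"
    using m by (simp add: dist_prod_def dist_real_def abs_mult sgn_if)
  ultimately show "\<exists>y\<in>{x. \<bar>fst x - \<eta> * soft Q (snd x)\<bar> < Q}. dist y z < e" by blast
qed

lemma active_ge:
  assumes rho: "\<bar>\<rho>\<bar> < 1" and z: "Q \<le> fst z - \<eta> * soft Q (snd z)"
    and k: "rate \<rho> (z - c) \<le> k" and e: "0 < e"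
  shows "\<forall>\<^sub>F p in sequentially. \<forall>(M :: 'a measure) G1 G2. gauss_pair \<rho> M G1 G2 \<longrightarrow>
    real p powr (- (k + e)) \<le> measure M {\<omega>\<in>space M. rescaled c G1 G2 p \<omega> \<notin> dead \<eta> Q}"
proof -
  have "open (- dead \<eta> Q)" using closed_dead by blast
  from gauss_pair_open_ge [OF rho this closure_active [OF z] e, of c]
  have "\<forall>\<^sub>F p in sequentially. \<forall>(M :: 'a measure) G1 G2. gauss_pair \<rho> M G1 G2 \<longrightarrow>
    real p powr (- (rate \<rho> (z - c) + e)) \<le> measure M {\<omega>\<in>space M. rescaled c G1 G2 p \<omega> \<notin> dead \<eta> Q}"
    by (simp add: rescaled_def)
  moreover have "\<forall>\<^sub>F p in sequentially. (1::nat) \<le> p" by (rule eventually_ge_at_top)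
  ultimately show ?thesis
  proof eventually_elim
    case (elim p)
    have "real p powr (- (k + e)) \<le> real p powr (- (rate \<rho> (z - c) + e))"
      using k elim(2) by (intro powr_mono) auto
    then show ?case using elim(1) order_trans by blast
  qed
qed

lemma dead_ge:
  assumes rho: "\<bar>\<rho>\<bar> < 1" and z: "z \<in> dead \<eta> Q" and Q: "0 < Q"
    and k: "rate \<rho> (z - c) \<le> k" and e: "0 < e"
  shows "\<forall>\<^sub>F p in sequentially. \<forall>(M :: 'a measure) G1 G2. gauss_pair \<rho> M G1 G2 \<longrightarrow>
    real p powr (- (k + e)) \<le> measure M {\<omega>\<in>space M. rescaled c G1 G2 p \<omega> \<in> dead \<eta> Q}"
proof -
  let ?I = "{x. \<bar>fst x - \<eta> * soft Q (snd x)\<bar> < Q}"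
  from gauss_pair_open_ge [OF rho open_dead_interior closure_dead_interior [OF z Q] e, of c]
  have "\<forall>\<^sub>F p in sequentially. \<forall>(M :: 'a measure) G1 G2. gauss_pair \<rho> M G1 G2 \<longrightarrow>
    real p powr (- (rate \<rho> (z - c) + e)) \<le> measure M {\<omega>\<in>space M. rescaled c G1 G2 p \<omega> \<in> ?I}"
    by (simp add: rescaled_def)
  moreover have "\<forall>\<^sub>F p in sequentially. (1::nat) \<le> p" by (rule eventually_ge_at_top)
  ultimately show ?thesis
  proof eventually_elim
    case (elim p)
    show ?case
    proof (intro allI impI)
      fix M :: "'a measure" and G1 G2
      assume G: "gauss_pair \<rho> M G1 G2"
      interpret prob_space M using G by (simp add: gauss_pair_def)
      have [measurable]: "G1 \<in> borel_measurable M" "G2 \<in> borel_measurable M"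
        using G by (simp_all add: gauss_pair_def)
      have [measurable]: "dead \<eta> Q \<in> sets borel" using closed_dead by (rule borel_closed)
      have "real p powr (- (k + e)) \<le> real p powr (- (rate \<rho> (z - c) + e))"
        using k elim(2) by (intro powr_mono) auto
      also have "\<dots> \<le> prob {\<omega>\<in>space M. rescaled c G1 G2 p \<omega> \<in> ?I}" using elim(1) G by blast
      also have "\<dots> \<le> prob {\<omega>\<in>space M. rescaled c G1 G2 p \<omega> \<in> dead \<eta> Q}"
      proof (intro finite_measure_mono)
        show "{\<omega>\<in>space M. rescaled c G1 G2 p \<omega> \<in> dead \<eta> Q} \<in> events" by measurable
      qed (auto simp: dead_def)
      finally show "real p powr (- (k + e)) \<le> prob {\<omega>\<in>space M. rescaled c G1 G2 p \<omega> \<in> dead \<eta> Q}" .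
    qed
  qed
qed

section \<open>Nearest points on lines\<close>

lemma rate_ge_fst: "\<bar>\<rho>\<bar> < 1 \<Longrightarrow> (fst x)\<^sup>2 \<le> rate \<rho> x"
proof -
  assume "\<bar>\<rho>\<bar> < 1"
  then have "0 < 1 - \<rho>\<^sup>2" by (simp add: abs_square_less_1)
  moreover have "dist2 \<rho> x (0, 0) = (snd x - \<rho> * fst x)\<^sup>2 + (1 - \<rho>\<^sup>2) * (fst x)\<^sup>2"
    by (simp add: dist2_def power2_eq_square algebra_simps)
  ultimately show ?thesis by (simp add: rate_def le_divide_eq mult.commute)
qed

text \<open>(1, rho) is the regression direction of the second coordinate on the first, so it leads
  to the nearest point of a vertical line and attains equality in
  \<open>rate_ge_fst\<close>.\<close>

lemma rate_fst_direction: "\<bar>\<rho>\<bar> < 1 \<Longrightarrow> rate \<rho> (t, \<rho> * t) = t\<^sup>2"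
proof -
  assume "\<bar>\<rho>\<bar> < 1"
  then have "0 < 1 - \<rho>\<^sup>2" by (simp add: abs_square_less_1)
  moreover have "dist2 \<rho> (t, \<rho> * t) (0, 0) = (1 - \<rho>\<^sup>2) * t\<^sup>2"
    by (simp add: dist2_def power2_eq_square algebra_simps)
  ultimately show ?thesis by (simp add: rate_def)
qed

text \<open>The vector (1 - rho eta, rho - eta) is the covariance matrix applied to the normal (1, -
  eta), hence the direction from a centre to the nearest point of a line x - eta y = const. Here v
  is the variance of G1 - eta G2 and g the signed gap to the line.\<close>

lemma rate_normal_direction:
  assumes "\<bar>\<rho>\<bar> < 1" and v: "v = 1 + \<eta>\<^sup>2 - 2 * \<rho> * \<eta>" "0 < v"
  shows "rate \<rho> (g / v * (1 - \<rho> * \<eta>), g / v * (\<rho> - \<eta>)) = g\<^sup>2 / v"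
proof -
  have r: "0 < 1 - \<rho>\<^sup>2" using assms(1) by (simp add: abs_square_less_1)
  have "dist2 \<rho> (k * (1 - \<rho> * \<eta>), k * (\<rho> - \<eta>)) (0, 0) = k\<^sup>2 * ((1 - \<rho>\<^sup>2) * (1 + \<eta>\<^sup>2 - 2 * \<rho> * \<eta>))" for k
    by (simp add: dist2_def power2_eq_square algebra_simps)
  from this [of "g / v"] have "dist2 \<rho> (g / v * (1 - \<rho> * \<eta>), g / v * (\<rho> - \<eta>)) (0, 0)
      = (g / v)\<^sup>2 * ((1 - \<rho>\<^sup>2) * v)"
    unfolding v(1) .
  also have "\<dots> = g\<^sup>2 / v * (1 - \<rho>\<^sup>2)" using v(2) by (simp add: power_divide power2_eq_square)
  finally show ?thesis using r by (simp add: rate_def)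
qed

lemma normal_direction_line:
  fixes \<rho> \<eta> :: real
  shows "(c1 + t * (1 - \<rho> * \<eta>)) - \<eta> * (c2 + t * (\<rho> - \<eta>)) = c1 - \<eta> * c2 + t * (1 + \<eta>\<^sup>2 - 2 * \<rho> * \<eta>)"
  by (simp add: power2_eq_square algebra_simps)

lemma dead_iff_large: "0 < Q \<Longrightarrow> Q \<le> x2 \<Longrightarrow> (x1, x2) \<in> dead \<eta> Q \<longleftrightarrow> \<bar>x1 - \<eta> * (x2 - Q)\<bar> \<le> Q"
  and dead_iff_small: "\<bar>x2\<bar> \<le> Q \<Longrightarrow> (x1, x2) \<in> dead \<eta> Q \<longleftrightarrow> \<bar>x1\<bar> \<le> Q"
  by (auto simp: dead_def soft_def)

lemma soft_cases:
  assumes "0 < (Q::real)"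
  obtains "x < - Q" "soft Q x = x + Q" | "\<bar>x\<bar> \<le> Q" "soft Q x = 0" | "Q < x" "soft Q x = x - Q"
  using assms by (cases "x < - Q"; cases "x > Q") (auto simp: soft_def abs_le_iff)

section \<open>Two zero coefficients\<close>

lemma null_active_le:
  assumes "\<bar>\<rho>\<bar> < 1" "0 < Q" "gauss_pair \<rho> M G1 G2" "2 \<le> p"
  shows "measure M {\<omega>\<in>space M. rescaled (0, 0) G1 G2 p \<omega> \<in> - dead \<eta> Q} \<le> 4 * real p powr (- Q\<^sup>2)"
proof -
  \<comment> \<open>While the partner stays in [-Q, Q], its soft threshold vanishes and the zero
    region is |x1| <= Q; a partner outside already costs Q^2.\<close>
  let ?hs = "[(1 :: real, 0 :: real, Q), (- 1, 0, Q), (0, 1, Q), (0, - 1, Q)]"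
  have "measure M {\<omega>\<in>space M. rescaled (0, 0) G1 G2 p \<omega> \<in> - dead \<eta> Q} \<le> length ?hs * real p powr (- Q\<^sup>2)"
  proof (rule gauss_pair_cover_le [OF assms(1,3,4)])
    fix x1 x2 assume "(x1, x2) \<in> - dead \<eta> Q"
    then show "\<exists>(a, b, T)\<in>set ?hs. T \<le> a * x1 + b * x2"
      using assms(2) by (cases x2 rule: soft_cases [OF assms(2)]) (auto simp: dead_def)
  qed (use assms(2) in \<open>auto simp: hcost_def covq_def pospart_def\<close>)
  then show ?thesis by simp
qed

lemma null_active_ge:
  assumes "\<bar>\<rho>\<bar> < 1" "0 < Q" "0 < e"
  shows "\<forall>\<^sub>F p in sequentially. \<forall>(M :: 'a measure) G1 G2. gauss_pair \<rho> M G1 G2 \<longrightarrow>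
    real p powr (- (Q\<^sup>2 + e)) \<le> measure M {\<omega>\<in>space M. rescaled (0, 0) G1 G2 p \<omega> \<notin> dead \<eta> Q}"
proof (rule active_ge [where z = "(Q, \<rho> * Q)"])
  \<comment> \<open>At the nearest point of the line x1 = Q the partner stays within its threshold,
    because |rho| < 1.\<close>
  have "\<bar>\<rho> * Q\<bar> \<le> Q" using assms by (simp add: abs_mult mult_left_le_one_le)
  then have "soft Q (\<rho> * Q) = 0" using assms soft_eq_0_iff [of Q "\<rho> * Q"] by simp
  then show "Q \<le> fst (Q, \<rho> * Q) - \<eta> * soft Q (snd (Q, \<rho> * Q))" by simp
  show "rate \<rho> ((Q, \<rho> * Q) - (0, 0)) \<le> Q\<^sup>2" using rate_fst_direction [OF assms(1), of Q] by simp
qed (use assms in auto)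

section \<open>A zero coefficient next to a signal\<close>

text \<open>For 0 <= kappa <= eta the line x - kappa y = (1 - kappa) Q passes through the corner (Q,
  Q) and supports the right-hand part of the active region where y >= -Q. The slope selects the
  nearest point: vertical edge (kappa = 0), corner, or slanted edge (kappa = eta). The other three
  half-planes cover the rest at cost at least Q^2, whence the minimum.\<close>

lemma neighbour_active_le:
  assumes eta: "0 \<le> \<eta>" "\<eta> \<le> \<rho>" "\<rho> < 1" and Q: "0 < Q" and R: "0 < R"
    and G: "gauss_pair \<rho> M G1 G2" and p: "2 \<le> p"
  shows "measure M {\<omega>\<in>space M. rescaled (\<rho> * R, R) G1 G2 p \<omega> \<in> - dead \<eta> Q}
    \<le> 4 * real p powr (- min (Q\<^sup>2) (f1 \<rho> \<eta> R Q))"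
proof -
  have rho: "\<bar>\<rho>\<bar> < 1" using eta by simp
  have r: "0 < 1 - \<rho>\<^sup>2" using rho by (simp add: abs_square_less_1)
  \<comment> \<open>In the middle branch (1, - kappa) is proportional to the inverse covariance
    matrix applied to the vector from the centre to (Q, Q), which makes the corner the nearest point
    of the half-plane.\<close>
  define \<kappa> where "\<kappa> = (if R \<le> Q / (1 + \<rho>) then 0
    else if R \<le> (1 + \<eta>) / (1 + \<rho>) * Q then (1 + \<rho>) * R / Q - 1 else \<eta>)"
  have \<kappa>: "0 \<le> \<kappa>" "\<kappa> \<le> \<eta>"
    using eta Q by (auto simp: \<kappa>_def field_simps)
  let ?hs = "[(1 :: real, - \<kappa>, (1 - \<kappa>) * Q), (0, - 1, Q), (- 1, 0, Q), (- 1, \<eta>, (1 + \<eta>) * Q)]"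
  have 1: "f1 \<rho> \<eta> R Q \<le> hcost \<rho> (\<rho> * R, R) (1, - \<kappa>, (1 - \<kappa>) * Q)"
  proof -
    consider "R \<le> Q / (1 + \<rho>)" | "\<not> R \<le> Q / (1 + \<rho>)" "R \<le> (1 + \<eta>) / (1 + \<rho>) * Q"
      | "\<not> R \<le> Q / (1 + \<rho>)" "\<not> R \<le> (1 + \<eta>) / (1 + \<rho>) * Q" by blast
    then show ?thesis
    proof cases
      case 1
      then show ?thesis using eta by (simp add: f1_def hcost_def \<kappa>_def covq_def)
    next
      case 2
      \<comment> \<open>N is the common factor: \<open>dist2\<close> is (1 - rho) N, the variance is
        (1 + rho) N / Q^2 and the gap of the centre to the half-plane is N / Q.\<close>
      define N where "N = 2 * Q\<^sup>2 - 2 * (1 + \<rho>) * R * Q + (1 + \<rho>) * R\<^sup>2"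
      have k: "\<kappa> * Q = (1 + \<rho>) * R - Q" using 2 Q by (simp add: \<kappa>_def field_simps)
      have cov: "covq \<rho> 1 (- \<kappa>) * Q\<^sup>2 = (1 + \<rho>) * N"
      proof -
        have "covq \<rho> 1 (- \<kappa>) * Q\<^sup>2 = Q\<^sup>2 + (\<kappa> * Q)\<^sup>2 - 2 * \<rho> * Q * (\<kappa> * Q)"
          by (simp add: covq_def power2_eq_square algebra_simps)
        also have "\<dots> = (1 + \<rho>) * N"
          unfolding k N_def by (simp add: power2_eq_square algebra_simps)
        finally show ?thesis .
      qed
      have cpos: "0 < covq \<rho> 1 (- \<kappa>)" by (rule covq_pos [OF rho]) simp
      then have "0 < (1 + \<rho>) * N" using Q unfolding cov [symmetric] by simp
      then have N: "0 < N" using eta by (simp add: zero_less_mult_iff)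
      have T: "((1 - \<kappa>) * Q - \<rho> * R + \<kappa> * R) * Q = N"
      proof -
        have "((1 - \<kappa>) * Q - \<rho> * R + \<kappa> * R) * Q = (Q - \<kappa> * Q) * Q - \<rho> * R * Q + (\<kappa> * Q) * R"
          by (simp add: algebra_simps)
        also have "\<dots> = N" unfolding k N_def by (simp add: power2_eq_square algebra_simps)
        finally show ?thesis .
      qed
      then have T0: "0 < (1 - \<kappa>) * Q - \<rho> * R + \<kappa> * R" using N Q by (metis zero_less_mult_pos2)
      have "dist2 \<bar>\<rho>\<bar> (Q, Q) (\<bar>\<rho>\<bar> * R, R) = (1 - \<rho>) * N"
        using eta by (simp add: dist2_def N_def power2_eq_square algebra_simps)
      then have "f1 \<rho> \<eta> R Q = (1 - \<rho>) * N / (1 - \<rho>\<^sup>2)" using 2 eta by (simp add: f1_def)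
      also have "(1 - \<rho>\<^sup>2) = (1 - \<rho>) * (1 + \<rho>)" by (simp add: power2_eq_square algebra_simps)
      also have "(1 - \<rho>) * N / ((1 - \<rho>) * (1 + \<rho>)) = N\<^sup>2 / ((1 + \<rho>) * N)"
        using N eta by (simp add: power2_eq_square)
      also have "\<dots> = (((1 - \<kappa>) * Q - \<rho> * R + \<kappa> * R) * Q)\<^sup>2 / (covq \<rho> 1 (- \<kappa>) * Q\<^sup>2)"
        unfolding T cov ..
      also have "\<dots> = ((1 - \<kappa>) * Q - \<rho> * R + \<kappa> * R)\<^sup>2 / covq \<rho> 1 (- \<kappa>)"
        using Q unfolding power_mult_distrib by simp
      also have "\<dots> = hcost \<rho> (\<rho> * R, R) (1, - \<kappa>, (1 - \<kappa>) * Q)"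
        using T0 by (simp add: hcost_def pospart_def)
      finally show ?thesis by simp
    next
      case 3
      then have "\<kappa> = \<eta>" by (simp add: \<kappa>_def)
      moreover have "hcost \<rho> (\<rho> * R, R) (1, - \<eta>, (1 - \<eta>) * Q)
          = (pospart ((1 - \<eta>) * Q - (\<rho> - \<eta>) * R))\<^sup>2 / (1 + \<eta>\<^sup>2 - 2 * \<rho> * \<eta>)"
        by (simp add: hcost_def covq_def algebra_simps)
      ultimately show ?thesis using 3 eta by (simp add: f1_def)
    qed
  qed
  \<comment> \<open>The centre has nonnegative coordinates, so it lies on the far side and the gaps
    are at least Q.\<close>
  have 2: "Q\<^sup>2 \<le> hcost \<rho> (\<rho> * R, R) (0, - 1, Q)" "Q\<^sup>2 \<le> hcost \<rho> (\<rho> * R, R) (- 1, 0, Q)"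
    using Q R eta by (auto simp: hcost_def covq_def pospart_def intro!: power_mono)
  have 3: "Q\<^sup>2 \<le> hcost \<rho> (\<rho> * R, R) (- 1, \<eta>, (1 + \<eta>) * Q)"
  proof -
    have pos: "0 < covq \<rho> (- 1) \<eta>" by (rule covq_pos [OF rho]) simp
    have "Q\<^sup>2 * covq \<rho> (- 1) \<eta> \<le> Q\<^sup>2 * (1 + \<eta>)\<^sup>2"
      using eta by (intro mult_left_mono) (auto simp: covq_def power2_eq_square algebra_simps)
    also have "\<dots> = ((1 + \<eta>) * Q)\<^sup>2" by (simp add: power_mult_distrib)
    also have "\<dots> \<le> (pospart ((1 + \<eta>) * Q + \<rho> * R - \<eta> * R))\<^sup>2"
    proof (intro power_mono)
      have "\<eta> * R \<le> \<rho> * R" using eta R by (intro mult_right_mono) auto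
      then have "(1 + \<eta>) * Q \<le> (1 + \<eta>) * Q + \<rho> * R - \<eta> * R" by linarith
      then show "(1 + \<eta>) * Q \<le> pospart ((1 + \<eta>) * Q + \<rho> * R - \<eta> * R)"
        unfolding pospart_def by (rule max.coboundedI1)
    qed (use eta Q in simp)
    finally show ?thesis using pos by (simp add: hcost_def le_divide_eq)
  qed
  have "measure M {\<omega>\<in>space M. rescaled (\<rho> * R, R) G1 G2 p \<omega> \<in> - dead \<eta> Q}
    \<le> length ?hs * real p powr (- min (Q\<^sup>2) (f1 \<rho> \<eta> R Q))"
  proof (rule gauss_pair_cover_le [OF rho G p])
    fix x1 x2 assume "(x1, x2) \<in> - dead \<eta> Q"
    then have x: "Q < \<bar>x1 - \<eta> * soft Q x2\<bar>" by (simp add: dead_def)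
    show "\<exists>(a, b, T)\<in>set ?hs. T \<le> a * x1 + b * x2"
    proof (cases x2 rule: soft_cases [OF Q])
      case 1
      then show ?thesis by simp
    next
      case 2
      have "\<kappa> * x2 \<le> \<kappa> * Q" using 2 \<kappa> by (intro mult_left_mono) auto
      then show ?thesis using 2 x by (auto simp: algebra_simps abs_if split: if_splits)
    next
      case 3
      have le: "\<kappa> * (x2 - Q) \<le> \<eta> * (x2 - Q)" using 3 \<kappa> by (intro mult_right_mono) auto
      have "Q < \<bar>x1 - \<eta> * (x2 - Q)\<bar>" using 3 x by simp
      then consider "Q < x1 - \<eta> * (x2 - Q)" | "Q < \<eta> * (x2 - Q) - x1" by linarith
      then show ?thesis
      proof cases
        case 1
        then have "(1 - \<kappa>) * Q \<le> 1 * x1 + - \<kappa> * x2" using le by (simp add: algebra_simps)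
        then show ?thesis by auto
      next
        case 2
        then have "(1 + \<eta>) * Q \<le> - 1 * x1 + \<eta> * x2" by (simp add: algebra_simps)
        then show ?thesis by auto
      qed
    qed
  qed (use 1 2 3 in \<open>auto simp: min_def\<close>)
  then show ?thesis by simp
qed

text \<open>Witnesses for the branches of \<open>f1\<close>: the foot on the vertical edge, the
  corner, and the foot on the slanted edge, or the centre itself once g <= 0. The branch conditions
  on R put each foot on the actual edge rather than on its extension.\<close>

lemma neighbour_active_ge:
  assumes eta: "0 \<le> \<eta>" "\<eta> \<le> \<rho>" "\<rho> < 1" and Q: "0 < Q" and R: "0 < R" and e: "0 < e"
  shows "\<forall>\<^sub>F p in sequentially. \<forall>(M :: 'a measure) G1 G2. gauss_pair \<rho> M G1 G2 \<longrightarrow>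
    real p powr (- (f1 \<rho> \<eta> R Q + e)) \<le> measure M {\<omega>\<in>space M. rescaled (\<rho> * R, R) G1 G2 p \<omega> \<notin> dead \<eta> Q}"
proof -
  have rho: "\<bar>\<rho>\<bar> < 1" using eta by simp
  have "\<exists>z1 z2. Q \<le> z1 - \<eta> * soft Q z2 \<and> rate \<rho> ((z1, z2) - (\<rho> * R, R)) \<le> f1 \<rho> \<eta> R Q"
  proof -
    consider "R \<le> Q / (1 + \<rho>)" | "\<not> R \<le> Q / (1 + \<rho>)" "R \<le> (1 + \<eta>) / (1 + \<rho>) * Q"
      | "\<not> R \<le> Q / (1 + \<rho>)" "\<not> R \<le> (1 + \<eta>) / (1 + \<rho>) * Q" by blast
    then show ?thesis
    proof cases
      case 1
      define z2 where "z2 = R + \<rho> * (Q - \<rho> * R)"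
      have le: "R + \<rho> * R \<le> Q" using 1 eta by (simp add: field_simps)
      then have "0 \<le> Q - \<rho> * R" using R by simp
      have "(1 - \<rho>) * (R + \<rho> * R) \<le> (1 - \<rho>) * Q" using le eta by (intro mult_left_mono) auto
      then have "z2 \<le> Q" by (simp add: z2_def algebra_simps)
      moreover have "0 \<le> z2" using \<open>0 \<le> Q - \<rho> * R\<close> R eta by (simp add: z2_def)
      ultimately have "soft Q z2 = 0" using soft_eq_0_iff [of Q z2] Q by simp
      moreover have "rate \<rho> ((Q, z2) - (\<rho> * R, R)) = (Q - \<rho> * R)\<^sup>2"
        using rate_fst_direction [OF rho, of "Q - \<rho> * R"] by (simp add: z2_def)
      ultimately show ?thesis using 1 eta \<open>0 \<le> Q - \<rho> * R\<close>
        by (intro exI [of _ Q] exI [of _ z2]) (simp add: f1_def pospart_def)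
    next
      case 2
      have "soft Q Q = 0" using Q by (simp add: soft_def)
      moreover have "rate \<rho> ((Q, Q) - (\<rho> * R, R)) = f1 \<rho> \<eta> R Q"
        using 2 eta by (simp add: f1_def rate_def dist2_def)
      ultimately show ?thesis by (intro exI [of _ Q]) simp
    next
      case 3
      define v where "v = 1 + \<eta>\<^sup>2 - 2 * \<rho> * \<eta>"
      have v: "0 < v" using covq_pos [OF rho, of 1 "- \<eta>"] by (simp add: v_def covq_def)
      define g where "g = (1 - \<eta>) * Q - (\<rho> - \<eta>) * R"
      have f1: "f1 \<rho> \<eta> R Q = (pospart g)\<^sup>2 / v" using 3 eta by (simp add: f1_def g_def v_def)
      have R3: "(1 + \<eta>) * Q \<le> (1 + \<rho>) * R" using 3 eta by (simp add: field_simps)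
      show ?thesis
      proof (cases "0 < g")
        case True
        define z1 z2 where "z1 = \<rho> * R + g / v * (1 - \<rho> * \<eta>)" and "z2 = R + g / v * (\<rho> - \<eta>)"
        have "z1 - \<eta> * z2 = \<rho> * R - \<eta> * R + g / v * v"
          unfolding z1_def z2_def normal_direction_line v_def ..
        then have "z1 - \<eta> * z2 = \<rho> * R - \<eta> * R + g" using v by simp
        then have line: "z1 - \<eta> * z2 = (1 - \<eta>) * Q" by (simp add: g_def algebra_simps)
        \<comment> \<open>Times 1 - rho, the branch condition becomes z2 >= Q with v cleared,
          because v - (rho - eta)^2 = 1 - rho^2 and v - (1 - eta)(rho - eta) = (1 - rho)(1 +
          eta).\<close>
        have "(1 - \<rho>) * ((1 + \<eta>) * Q) \<le> (1 - \<rho>) * ((1 + \<rho>) * R)" using R3 eta by (intro mult_left_mono) auto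
        then have "Q * v \<le> R * v + g * (\<rho> - \<eta>)"
          unfolding g_def v_def by (simp add: power2_eq_square algebra_simps)
        then have "Q \<le> z2" using v by (simp add: z2_def field_simps)
        then have soft: "soft Q z2 = z2 - Q" using Q by (simp add: soft_def)
        have "Q \<le> z1 - \<eta> * soft Q z2" unfolding soft using line by (simp add: algebra_simps)
        moreover have "rate \<rho> ((z1, z2) - (\<rho> * R, R)) = f1 \<rho> \<eta> R Q"
          using rate_normal_direction [OF rho v_def v, of g] True by (simp add: z1_def z2_def f1 pospart_def)
        ultimately show ?thesis by (intro exI [of _ z1] exI [of _ z2]) simp
      next
        case False
        have "Q \<le> R"
        proof (rule ccontr)
          assume "\<not> Q \<le> R"
          then have "(\<rho> - \<eta>) * R \<le> (\<rho> - \<eta>) * Q" using eta by (intro mult_left_mono) auto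
          moreover have "(\<rho> - \<eta>) * Q < (1 - \<eta>) * Q" using eta Q by simp
          ultimately show False using False by (simp add: g_def)
        qed
        then have soft: "soft Q R = R - Q" using Q by (simp add: soft_def)
        have "Q \<le> \<rho> * R - \<eta> * soft Q R" unfolding soft using False by (simp add: g_def algebra_simps)
        moreover have "rate \<rho> ((\<rho> * R, R) - (\<rho> * R, R)) \<le> f1 \<rho> \<eta> R Q"
          using v by (simp add: f1 rate_def dist2_def)
        ultimately show ?thesis by blast
      qed
    qed
  qed
  then obtain z1 z2 where "Q \<le> fst (z1, z2) - \<eta> * soft Q (snd (z1, z2))"
    "rate \<rho> ((z1, z2) - (\<rho> * R, R)) \<le> f1 \<rho> \<eta> R Q" by auto
  from active_ge [OF rho this e] show ?thesis .
qed

section \<open>A signal next to a zero coefficient\<close>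

text \<open>For eta >= 0 the zero region lies left of the vertical line where y <= Q and left of the
  slanted line where y > Q; \<open>f2\<close> is the smaller cost of these two half-planes.\<close>

lemma signal_dead_le:
  assumes eta: "0 \<le> \<eta>" "\<eta> \<le> \<rho>" "\<rho> < 1" and Q: "0 < Q" and R: "0 < R"
    and G: "gauss_pair \<rho> M G1 G2" and p: "2 \<le> p"
  shows "measure M {\<omega>\<in>space M. rescaled (R, \<rho> * R) G1 G2 p \<omega> \<in> dead \<eta> Q}
    \<le> 2 * real p powr (- f2 \<rho> \<eta> R Q)"
proof -
  have rho: "\<bar>\<rho>\<bar> < 1" using eta by simp
  let ?hs = "[(- 1 :: real, 0, - Q), (- 1, \<eta>, - ((1 - \<eta>) * Q))]"
  have "measure M {\<omega>\<in>space M. rescaled (R, \<rho> * R) G1 G2 p \<omega> \<in> dead \<eta> Q}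
    \<le> length ?hs * real p powr (- f2 \<rho> \<eta> R Q)"
  proof (rule gauss_pair_cover_le [OF rho G p])
    have "hcost \<rho> (R, \<rho> * R) (- 1, \<eta>, - ((1 - \<eta>) * Q))
        = (pospart ((1 - \<rho> * \<eta>) * R - (1 - \<eta>) * Q))\<^sup>2 / (1 + \<eta>\<^sup>2 - 2 * \<rho> * \<eta>)"
      by (simp add: hcost_def covq_def algebra_simps)
    moreover have "hcost \<rho> (R, \<rho> * R) (- 1, 0, - Q) = (pospart (R - Q))\<^sup>2"
      by (simp add: hcost_def covq_def)
    ultimately show "f2 \<rho> \<eta> R Q \<le> hcost \<rho> (R, \<rho> * R) h" if "h \<in> set ?hs" for h
      using that eta by (auto simp: f2_def)
    fix x1 x2 assume "(x1, x2) \<in> dead \<eta> Q"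
    then have x: "\<bar>x1 - \<eta> * soft Q x2\<bar> \<le> Q" by (simp add: dead_def)
    show "\<exists>(a, b, T)\<in>set ?hs. T \<le> a * x1 + b * x2"
    proof (cases x2 rule: soft_cases [OF Q])
      case 1
      have "\<eta> * (x2 + Q) \<le> 0" using 1 eta by (simp add: mult_le_0_iff)
      then show ?thesis using 1 x by (auto simp: abs_le_iff)
    next
      case 2
      then show ?thesis using x by (auto simp: abs_le_iff)
    next
      case 3
      then have "x1 - \<eta> * (x2 - Q) \<le> Q" using x by (simp add: abs_le_iff)
      then show ?thesis by (simp add: algebra_simps)
    qed
  qed auto
  then show ?thesis by simp
qed

text \<open>The foot (Q, rho Q) on the vertical line always lies in the zero region. The foot on the
  slanted line is used only when strictly cheaper, and then it is on the actual edge: where y < Q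
  that line has x <= Q, so by \<open>rate_ge_fst\<close> the foot would cost at least (R - Q)^2. A
  centre already in the region costs nothing.\<close>

lemma signal_dead_ge:
  assumes eta: "0 \<le> \<eta>" "\<eta> \<le> \<rho>" "\<rho> < 1" and Q: "0 < Q" and R: "0 < R" and e: "0 < e"
  shows "\<forall>\<^sub>F p in sequentially. \<forall>(M :: 'a measure) G1 G2. gauss_pair \<rho> M G1 G2 \<longrightarrow>
    real p powr (- (f2 \<rho> \<eta> R Q + e)) \<le> measure M {\<omega>\<in>space M. rescaled (R, \<rho> * R) G1 G2 p \<omega> \<in> dead \<eta> Q}"
proof -
  have rho: "\<bar>\<rho>\<bar> < 1" using eta by simp
  define v where "v = 1 + \<eta>\<^sup>2 - 2 * \<rho> * \<eta>"
  have v: "0 < v" using covq_pos [OF rho, of 1 "- \<eta>"] by (simp add: v_def covq_def)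
  define g where "g = (1 - \<rho> * \<eta>) * R - (1 - \<eta>) * Q"
  have f2: "f2 \<rho> \<eta> R Q = min ((pospart (R - Q))\<^sup>2) ((pospart g)\<^sup>2 / v)"
    using eta by (simp add: f2_def g_def v_def)
  have f2_nonneg: "0 \<le> f2 \<rho> \<eta> R Q" using v by (simp add: f2)
  have c: "rate \<rho> ((R, \<rho> * R) - (R, \<rho> * R)) \<le> f2 \<rho> \<eta> R Q" using f2_nonneg by (simp add: rate_def dist2_def)
  have "\<exists>z. z \<in> dead \<eta> Q \<and> rate \<rho> (z - (R, \<rho> * R)) \<le> f2 \<rho> \<eta> R Q"
  proof (cases "R \<le> Q")
    case True
    have "\<rho> * R \<le> R" using eta R by (simp add: mult_left_le_one_le)
    from order_trans [OF this True] have "\<bar>\<rho> * R\<bar> \<le> Q" using eta R by (simp add: abs_mult)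
    then show ?thesis using c True R by (intro exI [of _ "(R, \<rho> * R)"]) (simp add: dead_iff_small)
  next
    case RQ: False
    show ?thesis
    proof (cases "(pospart (R - Q))\<^sup>2 \<le> (pospart g)\<^sup>2 / v")
      case True
      have "\<bar>\<rho> * Q\<bar> \<le> Q" using eta Q by (simp add: abs_mult mult_left_le_one_le)
      then have "(Q, \<rho> * Q) \<in> dead \<eta> Q" using Q by (simp add: dead_iff_small)
      moreover have "rate \<rho> ((Q, \<rho> * Q) - (R, \<rho> * R)) = (R - Q)\<^sup>2"
        using rate_fst_direction [OF rho, of "Q - R"] by (simp add: right_diff_distrib power2_commute)
      ultimately show ?thesis using True RQ by (intro exI [of _ "(Q, \<rho> * Q)"]) (simp add: f2 pospart_def)
    next
      case False
      then have lt: "(pospart g)\<^sup>2 / v < (R - Q)\<^sup>2" using RQ by (simp add: pospart_def)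
      show ?thesis
      proof (cases "0 < g")
        case True
        define z1 z2 where "z1 = R - g / v * (1 - \<rho> * \<eta>)" and "z2 = \<rho> * R - g / v * (\<rho> - \<eta>)"
        have "z1 - \<eta> * z2 = R - \<eta> * (\<rho> * R) + - (g / v) * v"
          using normal_direction_line [of R "- (g / v)" \<rho> \<eta> "\<rho> * R"] by (simp add: z1_def z2_def v_def)
        then have "z1 - \<eta> * z2 = R - \<eta> * (\<rho> * R) - g" using v by simp
        then have line: "z1 - \<eta> * z2 = (1 - \<eta>) * Q" by (simp add: g_def algebra_simps)
        have rate: "rate \<rho> ((z1, z2) - (R, \<rho> * R)) = g\<^sup>2 / v"
          using rate_normal_direction [OF rho v_def v, of "- g"] by (simp add: z1_def z2_def)
        have "Q \<le> z2"
        proof (rule ccontr)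
          assume "\<not> Q \<le> z2"
          then have "\<eta> * z2 \<le> \<eta> * Q" using eta by (intro mult_left_mono) auto
          then have "z1 \<le> Q" using line by (simp add: algebra_simps)
          then have "(R - Q)\<^sup>2 \<le> (R - z1)\<^sup>2" using RQ by (intro power_mono) auto
          also have "\<dots> \<le> g\<^sup>2 / v"
            using rate_ge_fst [OF rho, of "(z1, z2) - (R, \<rho> * R)"] unfolding rate by (simp add: power2_commute)
          finally show False using lt True by (simp add: pospart_def)
        qed
        moreover have "z1 - \<eta> * (z2 - Q) = Q" using line by (simp add: algebra_simps)
        ultimately have "(z1, z2) \<in> dead \<eta> Q" using Q by (simp add: dead_iff_large)
        then show ?thesis using rate False True lt RQ
          by (intro exI [of _ "(z1, z2)"]) (simp add: f2 pospart_def)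
      next
        case False
        have "\<eta> * Q \<le> \<eta> * (\<rho> * R)" using False RQ by (simp add: g_def algebra_simps)
        moreover have "\<eta> \<noteq> 0" using False RQ by (auto simp: g_def)
        ultimately have "Q \<le> \<rho> * R" using eta by simp
        moreover have "\<bar>R - \<eta> * (\<rho> * R - Q)\<bar> \<le> Q"
        proof -
          have "\<eta> * \<rho> * R \<le> 1 * R" using eta R by (intro mult_right_mono mult_le_one) auto
          moreover have "0 \<le> \<eta> * Q" using eta Q by simp
          ultimately have "0 \<le> R - \<eta> * (\<rho> * R - Q)" by (simp add: algebra_simps)
          then show ?thesis using False by (simp add: g_def algebra_simps)
        qed
        ultimately have "(R, \<rho> * R) \<in> dead \<eta> Q" using Q by (simp add: dead_iff_large)
        then show ?thesis using c by blast
      qed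
    qed
  qed
  then show ?thesis using dead_ge [OF rho _ Q _ e] by blast
qed

section \<open>Two signals\<close>

text \<open>A reflection would turn two equal signals into opposite ones, so both signs of rho are
  handled here. For eta < 0 the slanted half-plane alone contains the zero region; for eta >= 0 the
  vertical one is added, whose cost is at least \<open>f3\<close> because (1 - eta)^2 <= v.\<close>

lemma two_signals_dead_le:
  assumes rho: "\<bar>\<rho>\<bar> < 1" and eta: "0 \<le> \<eta> \<and> \<eta> \<le> \<rho> \<or> \<rho> \<le> \<eta> \<and> \<eta> \<le> 0" and Q: "0 < Q" and R: "0 < R"
    and G: "gauss_pair \<rho> M G1 G2" and p: "2 \<le> p"
  shows "measure M {\<omega>\<in>space M. rescaled ((1 + \<rho>) * R, (1 + \<rho>) * R) G1 G2 p \<omega> \<in> dead \<eta> Q}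
    \<le> 2 * real p powr (- f3 \<rho> \<eta> R Q)"
proof -
  define m where "m = (1 + \<rho>) * R"
  define v where "v = 1 + \<eta>\<^sup>2 - 2 * \<rho> * \<eta>"
  have v: "0 < v" using covq_pos [OF rho, of 1 "- \<eta>"] by (simp add: v_def covq_def)
  have f3: "f3 \<rho> \<eta> R Q = (1 - \<eta>)\<^sup>2 * (pospart (m - Q))\<^sup>2 / v" by (simp add: f3_def m_def v_def)
  let ?hs = "(- 1 :: real, \<eta>, - ((1 - \<eta>) * Q)) # (if 0 \<le> \<eta> then [(- 1, 0, - Q)] else [])"
  have 1: "f3 \<rho> \<eta> R Q \<le> hcost \<rho> (m, m) (- 1, \<eta>, - ((1 - \<eta>) * Q))"
  proof -
    have "m - (1 - \<eta>) * Q - \<eta> * m = (1 - \<eta>) * (m - Q)" by (simp add: algebra_simps)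
    moreover have "pospart ((1 - \<eta>) * (m - Q)) = (1 - \<eta>) * pospart (m - Q)"
      using rho eta by (auto simp: pospart_def max_def zero_le_mult_iff mult_le_0_iff)
    ultimately show ?thesis by (simp add: f3 hcost_def covq_def v_def power_mult_distrib)
  qed
  have 2: "f3 \<rho> \<eta> R Q \<le> hcost \<rho> (m, m) (- 1, 0, - Q)" if "0 \<le> \<eta>"
  proof -
    have "0 \<le> \<eta> * (1 - \<rho>)" using that rho by simp
    then have "(1 - \<eta>)\<^sup>2 \<le> v" by (simp add: v_def power2_eq_square algebra_simps)
    then have "(1 - \<eta>)\<^sup>2 * (pospart (m - Q))\<^sup>2 \<le> v * (pospart (m - Q))\<^sup>2" by (intro mult_right_mono) auto
    then show ?thesis using v by (simp add: f3 hcost_def covq_def divide_le_eq mult.commute)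
  qed
  have "measure M {\<omega>\<in>space M. rescaled (m, m) G1 G2 p \<omega> \<in> dead \<eta> Q}
    \<le> length ?hs * real p powr (- f3 \<rho> \<eta> R Q)"
  proof (rule gauss_pair_cover_le [OF rho G p])
    show "f3 \<rho> \<eta> R Q \<le> hcost \<rho> (m, m) h" if "h \<in> set ?hs" for h
      using that 1 2 by (auto split: if_splits)
    show "a \<noteq> 0 \<or> b \<noteq> 0" if "(a, b, T) \<in> set ?hs" for a b T
      using that by (auto split: if_splits)
    fix x1 x2 assume "(x1, x2) \<in> dead \<eta> Q"
    then have x: "\<bar>x1 - \<eta> * soft Q x2\<bar> \<le> Q" by (simp add: dead_def)
    show "\<exists>(a, b, T)\<in>set ?hs. T \<le> a * x1 + b * x2"
    proof (cases "0 \<le> \<eta>")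
      case True
      show ?thesis
      proof (cases x2 rule: soft_cases [OF Q])
        case 1
        have "\<eta> * (x2 + Q) \<le> 0" using 1 True by (simp add: mult_le_0_iff)
        then show ?thesis using 1 x True by (auto simp: abs_le_iff)
      next
        case 2
        then show ?thesis using x True by (auto simp: abs_le_iff)
      next
        case 3
        then have "x1 - \<eta> * (x2 - Q) \<le> Q" using x by (simp add: abs_le_iff)
        then show ?thesis by (simp add: algebra_simps)
      qed
    next
      case False
      have "\<eta> * Q \<le> 0" using False Q by (simp add: mult_le_0_iff)
      have "- ((1 - \<eta>) * Q) \<le> - 1 * x1 + \<eta> * x2"
      proof (cases x2 rule: soft_cases [OF Q])
        case 2
        have "\<eta> * Q \<le> \<eta> * x2" using 2 False by (intro mult_left_mono_neg) auto
        then show ?thesis using 2 x by (simp add: algebra_simps abs_le_iff)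
      next
        case 1
        then have "x1 - \<eta> * (x2 + Q) \<le> Q" using x by (simp add: abs_le_iff)
        then show ?thesis using \<open>\<eta> * Q \<le> 0\<close> by (simp add: algebra_simps)
      next
        case 3
        then have "x1 - \<eta> * (x2 - Q) \<le> Q" using x by (simp add: abs_le_iff)
        then show ?thesis by (simp add: algebra_simps)
      qed
      then show ?thesis by simp
    qed
  qed
  also have "\<dots> \<le> 2 * real p powr (- f3 \<rho> \<eta> R Q)" by (intro mult_right_mono) auto
  finally show ?thesis by (simp add: m_def)
qed

lemma two_signals_dead_ge:
  assumes rho: "\<bar>\<rho>\<bar> < 1" and eta: "0 \<le> \<eta> \<and> \<eta> \<le> \<rho> \<or> \<rho> \<le> \<eta> \<and> \<eta> \<le> 0" and Q: "0 < Q" and R: "0 < R"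
    and e: "0 < e"
  shows "\<forall>\<^sub>F p in sequentially. \<forall>(M :: 'a measure) G1 G2. gauss_pair \<rho> M G1 G2 \<longrightarrow>
    real p powr (- (f3 \<rho> \<eta> R Q + e)) \<le>
      measure M {\<omega>\<in>space M. rescaled ((1 + \<rho>) * R, (1 + \<rho>) * R) G1 G2 p \<omega> \<in> dead \<eta> Q}"
proof -
  define m where "m = (1 + \<rho>) * R"
  have m: "0 < m" using rho R by (simp add: m_def)
  define v where "v = 1 + \<eta>\<^sup>2 - 2 * \<rho> * \<eta>"
  have v: "0 < v" using covq_pos [OF rho, of 1 "- \<eta>"] by (simp add: v_def covq_def)
  have f3: "f3 \<rho> \<eta> R Q = (1 - \<eta>)\<^sup>2 * (pospart (m - Q))\<^sup>2 / v" by (simp add: f3_def m_def v_def)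
  have "\<exists>z. z \<in> dead \<eta> Q \<and> rate \<rho> (z - (m, m)) \<le> f3 \<rho> \<eta> R Q"
  proof (cases "m \<le> Q")
    case True
    then show ?thesis using m
      by (intro exI [of _ "(m, m)"]) (simp add: dead_iff_small rate_def dist2_def f3 pospart_def)
  next
    case False
    define g where "g = (1 - \<eta>) * (m - Q)"
    define z1 z2 where "z1 = m - g / v * (1 - \<rho> * \<eta>)" and "z2 = m - g / v * (\<rho> - \<eta>)"
    have "z1 - \<eta> * z2 = m - \<eta> * m + - (g / v) * v"
      using normal_direction_line [of m "- (g / v)" \<rho> \<eta> m] by (simp add: z1_def z2_def v_def)
    then have "z1 - \<eta> * z2 = m - \<eta> * m - g" using v by simp
    then have line: "z1 - \<eta> * (z2 - Q) = Q" by (simp add: g_def algebra_simps)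
    \<comment> \<open>This product equals v - (rho - eta)(1 - eta); its sign puts the foot at height
      at least Q, on the actual slanted edge.\<close>
    have "0 \<le> (1 - \<rho>) * (1 + \<eta>)" using rho eta by (intro mult_nonneg_nonneg) auto
    then have "(\<rho> - \<eta>) * (1 - \<eta>) \<le> v" by (simp add: v_def power2_eq_square algebra_simps)
    then have "(\<rho> - \<eta>) * (1 - \<eta>) * (m - Q) \<le> v * (m - Q)" using False by (intro mult_right_mono) auto
    then have "g * (\<rho> - \<eta>) \<le> (m - Q) * v" by (simp add: g_def ac_simps)
    then have "g / v * (\<rho> - \<eta>) \<le> m - Q" using v by (simp add: divide_le_eq)
    then have "Q \<le> z2" by (simp add: z2_def)
    then have "(z1, z2) \<in> dead \<eta> Q" using Q line by (simp add: dead_iff_large)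
    moreover have "rate \<rho> ((z1, z2) - (m, m)) = g\<^sup>2 / v"
      using rate_normal_direction [OF rho v_def v, of "- g"] by (simp add: z1_def z2_def)
    ultimately show ?thesis using False
      by (intro exI [of _ "(z1, z2)"]) (simp add: f3 g_def pospart_def power_mult_distrib)
  qed
  then show ?thesis using dead_ge [OF rho _ Q _ e] unfolding m_def by blast
qed

section \<open>From one pair to the whole design\<close>

lemma rescaled_uminus_fst:
  "rescaled (- c1, c2) (\<lambda>\<omega>. - G1 \<omega>) G2 p \<omega> \<in> dead (- \<eta>) Q \<longleftrightarrow> rescaled (c1, c2) G1 G2 p \<omega> \<in> dead \<eta> Q"
  using dead_uminus_fst [of "c1 + G1 \<omega> / logscale p" "c2 + G2 \<omega> / logscale p" \<eta> Q]
  by (simp add: rescaled_def)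

lemma rescaled_uminus_snd:
  assumes "0 \<le> Q"
  shows "rescaled (c1, - c2) G1 (\<lambda>\<omega>. - G2 \<omega>) p \<omega> \<in> dead (- \<eta>) Q \<longleftrightarrow> rescaled (c1, c2) G1 G2 p \<omega> \<in> dead \<eta> Q"
  using dead_uminus_snd [OF assms, of "c1 + G1 \<omega> / logscale p" "c2 + G2 \<omega> / logscale p" \<eta>]
  by (simp add: rescaled_def)

lemma f1_uminus: "f1 (- \<rho>) (- \<eta>) = f1 \<rho> \<eta>"
  by (simp add: f1_def fun_eq_iff)

lemma f2_uminus: "f2 (- \<rho>) (- \<eta>) = f2 \<rho> \<eta>"
  by (simp add: f2_def fun_eq_iff)

text \<open>Reflections exchange the two disjuncts, so results for the first one transfer to the
  second.\<close>

definition compatible :: "real \<Rightarrow> real \<Rightarrow> bool" where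
  "compatible \<rho> \<eta> \<longleftrightarrow> 0 \<le> \<eta> \<and> \<eta> \<le> \<rho> \<and> \<rho> < 1 \<or> - 1 < \<rho> \<and> \<rho> \<le> \<eta> \<and> \<eta> \<le> 0"

lemma compatible_shrink:
  assumes "\<bar>\<rho>\<bar> < 1" "0 < \<mu>"
  shows "compatible \<rho> (\<rho> / (1 + \<mu>))"
proof (cases "0 \<le> \<rho>")
  case True
  then have "0 \<le> \<rho> * \<mu>" using assms by simp
  then show ?thesis using True assms by (simp add: compatible_def field_simps)
next
  case False
  then have "\<rho> * \<mu> \<le> 0" using assms by (simp add: mult_le_0_iff)
  then show ?thesis using False assms by (simp add: compatible_def field_simps)
qed

text \<open>For negative rho the first coordinate is reflected: rho and eta change sign while the
  neighbour's signal mean R stays positive.\<close>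

lemma neighbour_active_le':
  assumes c: "compatible \<rho> \<eta>" and QR: "0 < Q" "0 < R" and G: "gauss_pair \<rho> M G1 G2" and p: "2 \<le> p"
  shows "measure M {\<omega>\<in>space M. rescaled (\<rho> * R, R) G1 G2 p \<omega> \<notin> dead \<eta> Q}
    \<le> 4 * real p powr (- min (Q\<^sup>2) (f1 \<rho> \<eta> R Q))"
proof (cases "0 \<le> \<eta> \<and> \<eta> \<le> \<rho> \<and> \<rho> < 1")
  case True
  then show ?thesis using neighbour_active_le [OF _ _ _ QR G p, of \<eta>] by simp
next
  case False
  then have "- 1 < \<rho>" "\<rho> \<le> \<eta>" "\<eta> \<le> 0" using c by (auto simp: compatible_def)
  then show ?thesis
    using neighbour_active_le [OF _ _ _ QR gauss_pair_uminus1 [OF G] p, of "- \<eta>"]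
    by (simp add: rescaled_uminus_fst f1_uminus)
qed

lemma neighbour_active_ge':
  assumes c: "compatible \<rho> \<eta>" and QR: "0 < Q" "0 < R" and e: "0 < e"
  shows "\<forall>\<^sub>F p in sequentially. \<forall>(M :: 'a measure) G1 G2. gauss_pair \<rho> M G1 G2 \<longrightarrow>
    real p powr (- (f1 \<rho> \<eta> R Q + e)) \<le> measure M {\<omega>\<in>space M. rescaled (\<rho> * R, R) G1 G2 p \<omega> \<notin> dead \<eta> Q}"
proof (cases "0 \<le> \<eta> \<and> \<eta> \<le> \<rho> \<and> \<rho> < 1")
  case True
  then show ?thesis using neighbour_active_ge [OF _ _ _ QR e] by blast
next
  case False
  then have "\<forall>\<^sub>F p in sequentially. \<forall>(M :: 'a measure) G1 G2. gauss_pair (- \<rho>) M G1 G2 \<longrightarrow>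
    real p powr (- (f1 (- \<rho>) (- \<eta>) R Q + e)) \<le>
      measure M {\<omega>\<in>space M. rescaled (- \<rho> * R, R) G1 G2 p \<omega> \<notin> dead (- \<eta>) Q}"
    using c by (intro neighbour_active_ge QR e) (auto simp: compatible_def)
  then show ?thesis
  proof eventually_elim
    case (elim p)
    show ?case
    proof (intro allI impI)
      fix M :: "'a measure" and G1 G2
      assume "gauss_pair \<rho> M G1 G2"
      from elim [rule_format, OF gauss_pair_uminus1 [OF this]]
      show "real p powr (- (f1 \<rho> \<eta> R Q + e)) \<le> measure M {\<omega>\<in>space M. rescaled (\<rho> * R, R) G1 G2 p \<omega> \<notin> dead \<eta> Q}"
        by (simp add: rescaled_uminus_fst f1_uminus)
    qed
  qed
qed

text \<open>The signal sits in the first coordinate here, so it is the second one that is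
  reflected.\<close>

lemma signal_dead_le':
  assumes c: "compatible \<rho> \<eta>" and QR: "0 < Q" "0 < R" and G: "gauss_pair \<rho> M G1 G2" and p: "2 \<le> p"
  shows "measure M {\<omega>\<in>space M. rescaled (R, \<rho> * R) G1 G2 p \<omega> \<in> dead \<eta> Q}
    \<le> 2 * real p powr (- f2 \<rho> \<eta> R Q)"
proof (cases "0 \<le> \<eta> \<and> \<eta> \<le> \<rho> \<and> \<rho> < 1")
  case True
  then show ?thesis using signal_dead_le [OF _ _ _ QR G p, of \<eta>] by simp
next
  case False
  then have "- 1 < \<rho>" "\<rho> \<le> \<eta>" "\<eta> \<le> 0" using c by (auto simp: compatible_def)
  then show ?thesis
    using signal_dead_le [OF _ _ _ QR gauss_pair_uminus2 [OF G] p, of "- \<eta>"] QR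
    by (simp add: rescaled_uminus_snd f2_uminus)
qed

lemma signal_dead_ge':
  assumes c: "compatible \<rho> \<eta>" and QR: "0 < Q" "0 < R" and e: "0 < e"
  shows "\<forall>\<^sub>F p in sequentially. \<forall>(M :: 'a measure) G1 G2. gauss_pair \<rho> M G1 G2 \<longrightarrow>
    real p powr (- (f2 \<rho> \<eta> R Q + e)) \<le> measure M {\<omega>\<in>space M. rescaled (R, \<rho> * R) G1 G2 p \<omega> \<in> dead \<eta> Q}"
proof (cases "0 \<le> \<eta> \<and> \<eta> \<le> \<rho> \<and> \<rho> < 1")
  case True
  then show ?thesis using signal_dead_ge [OF _ _ _ QR e] by blast
next
  case False
  then have "\<forall>\<^sub>F p in sequentially. \<forall>(M :: 'a measure) G1 G2. gauss_pair (- \<rho>) M G1 G2 \<longrightarrow>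
    real p powr (- (f2 (- \<rho>) (- \<eta>) R Q + e)) \<le>
      measure M {\<omega>\<in>space M. rescaled (R, - \<rho> * R) G1 G2 p \<omega> \<in> dead (- \<eta>) Q}"
    using c by (intro signal_dead_ge QR e) (auto simp: compatible_def)
  then show ?thesis
  proof eventually_elim
    case (elim p)
    show ?case
    proof (intro allI impI)
      fix M :: "'a measure" and G1 G2
      assume "gauss_pair \<rho> M G1 G2"
      from elim [rule_format, OF gauss_pair_uminus2 [OF this]]
      show "real p powr (- (f2 \<rho> \<eta> R Q + e)) \<le> measure M {\<omega>\<in>space M. rescaled (R, \<rho> * R) G1 G2 p \<omega> \<in> dead \<eta> Q}"
        using QR by (simp add: rescaled_uminus_snd f2_uminus)
    qed
  qed
qed

section \<open>Scores under the block design\<close>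

text \<open>A combination of two scores is linear in the noise, with coefficient vector a X_j + b
  X_k, whose squared norm is read off the Gram matrix. The case j = k is allowed and gives
  correlation 1.\<close>

lemma gauss_pair_score:
  assumes design: "\<And>j k. j < p \<Longrightarrow> k < p \<Longrightarrow> (\<Sum>i<n. X i j * X i k) = gram \<rho> j k"
    and jk: "j < p" "k < p"
  shows "gauss_pair (gram \<rho> j k) (PiM {..<n} (\<lambda>_. std_normal)) (\<lambda>z. score n X z j) (\<lambda>z. score n X z k)"
  unfolding gauss_pair_def
proof (intro conjI allI impI)
  show "prob_space (PiM {..<n} (\<lambda>_. std_normal))" by (intro prob_space_PiM prob_space_std_normal)
  show "(\<lambda>z. score n X z j) \<in> borel_measurable (PiM {..<n} (\<lambda>_. std_normal))"
    "(\<lambda>z. score n X z k) \<in> borel_measurable (PiM {..<n} (\<lambda>_. std_normal))"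
    unfolding score_def by measurable
  fix a b assume pos: "0 < covq (gram \<rho> j k) a b"
  have "(\<Sum>i<n. (a * X i j + b * X i k)\<^sup>2)
      = a\<^sup>2 * (\<Sum>i<n. X i j * X i j) + b\<^sup>2 * (\<Sum>i<n. X i k * X i k) + 2 * a * b * (\<Sum>i<n. X i j * X i k)"
    unfolding sum_distrib_left sum.distrib [symmetric]
    by (intro sum.cong) (simp_all add: power2_eq_square algebra_simps)
  then have "covq (gram \<rho> j k) a b = (\<Sum>i<n. (a * X i j + b * X i k)\<^sup>2)"
    using design jk by (simp add: covq_def gram_def)
  from linear_std_normal [OF this pos]
  show "distributed (PiM {..<n} (\<lambda>_. std_normal)) lborel (\<lambda>\<omega>. a * score n X \<omega> j + b * score n X \<omega> k)
      (normal_density 0 (sqrt (covq (gram \<rho> j k) a b)))"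
    by (simp add: score_def sum_distrib_left sum.distrib algebra_simps)
qed

lemma score_response:
  assumes design: "\<And>j k. j < p \<Longrightarrow> k < p \<Longrightarrow> (\<Sum>i<n. X i j * X i k) = gram \<rho> j k"
    and j: "j < p"
  shows "score n X (response n p X b z) j = b j + (if nbr j < p then \<rho> * b (nbr j) else 0) + score n X z j"
proof -
  have "(\<Sum>i<n. X i j * (\<Sum>k<p. X i k * b k)) = (\<Sum>k<p. (\<Sum>i<n. X i j * X i k) * b k)"
    unfolding sum_distrib_left sum_distrib_right by (subst sum.swap) (simp add: ac_simps)
  also have "\<dots> = (\<Sum>k<p. gram \<rho> j k * b k)" using design j by (intro sum.cong) auto
  finally show ?thesis
    by (simp add: score_def response_def distrib_left sum.distrib gram_sum [OF j])
qed

section \<open>Signals and noise in the product model\<close>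

lemma sets_beta_law [simp]: "sets (beta_law tau eps) = UNIV"
  and space_beta_law [simp]: "space (beta_law tau eps) = UNIV"
  by (simp_all add: beta_law_def)

lemma prob_space_beta_law: "prob_space (beta_law tau eps)"
  unfolding beta_law_def by (rule prob_space_measure_pmf)

lemma
  assumes "tau \<noteq> 0" "0 \<le> eps" "eps \<le> 1"
  shows measure_beta_law_tau: "measure (beta_law tau eps) {tau} = eps"
    and measure_beta_law_0: "measure (beta_law tau eps) {0} = 1 - eps"
    and measure_beta_law_compl: "measure (beta_law tau eps) (- {0, tau}) = 0"
proof -
  have eq: "(\<lambda>b. if b then tau else 0) -` {tau} = {True}" "(\<lambda>b. if b then tau else 0) -` {0} = {False}"
    "(\<lambda>b. if b then tau else 0) -` (- {0, tau}) = {}"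
    using assms by (auto split: if_splits)
  then show "measure (beta_law tau eps) {tau} = eps" "measure (beta_law tau eps) {0} = 1 - eps"
    "measure (beta_law tau eps) (- {0, tau}) = 0"
    unfolding beta_law_def measure_map_pmf eq using assms by (simp_all add: measure_pmf_single)
qed

lemma prob_space_model: "prob_space (model p n tau eps)"
proof -
  interpret B: prob_space "PiM {..<p} (\<lambda>_. beta_law tau eps)" by (intro prob_space_PiM prob_space_beta_law)
  interpret N: prob_space "PiM {..<n} (\<lambda>_. std_normal)" by (intro prob_space_PiM prob_space_std_normal)
  interpret pair_prob_space "PiM {..<p} (\<lambda>_. beta_law tau eps)" "PiM {..<n} (\<lambda>_. std_normal)" ..
  show ?thesis unfolding model_def by unfold_locales
qed

lemma
  fixes p n :: nat and tau eps :: real and S T :: "real set" and Z :: "(nat \<Rightarrow> real) set"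
  defines "N \<equiv> PiM {..<n} (\<lambda>_. std_normal)"
  assumes jk: "j < p" "k < p" "j \<noteq> k" and Z: "Z \<in> sets N"
  defines "rect \<equiv> {\<omega>\<in>space (model p n tau eps). fst \<omega> j \<in> S \<and> fst \<omega> k \<in> T \<and> snd \<omega> \<in> Z}"
  shows model_rect_sets: "rect \<in> sets (model p n tau eps)"
    and measure_model_rect: "measure (model p n tau eps) rect
      = measure (beta_law tau eps) S * measure (beta_law tau eps) T * measure N Z"
proof -
  let ?B = "PiM {..<p} (\<lambda>_. beta_law tau eps)"
  interpret B: prob_space ?B by (intro prob_space_PiM prob_space_beta_law)
  interpret N: prob_space N unfolding N_def by (intro prob_space_PiM prob_space_std_normal)
  interpret beta: prob_space "beta_law tau eps" by (rule prob_space_beta_law)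
  interpret PB: product_prob_space "\<lambda>_. beta_law tau eps" "{..<p}" by unfold_locales
  define H where "H = {\<beta>\<in>space ?B. \<forall>i\<in>{j, k}. \<beta> i \<in> (if i = j then S else T)}"
  have H: "emeasure ?B H = (\<Prod>i\<in>{j, k}. emeasure (beta_law tau eps) (if i = j then S else T))"
    unfolding H_def using jk by (intro PB.emeasure_PiM_Collect) auto
  have Hs: "H \<in> sets ?B"
  proof -
    have "{\<beta>\<in>space ?B. \<beta> i \<in> U} \<in> sets ?B" if "i < p" for i U
    proof -
      have "(\<lambda>\<beta>. \<beta> i) -` U \<inter> space ?B \<in> sets ?B"
        using that by (intro measurable_sets [OF measurable_component_singleton]) auto
      moreover have "{\<beta>\<in>space ?B. \<beta> i \<in> U} = (\<lambda>\<beta>. \<beta> i) -` U \<inter> space ?B" by auto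
      ultimately show ?thesis by simp
    qed
    then show ?thesis unfolding H_def using jk by (intro sets.sets_Collect_finite_All') auto
  qed
  have rect: "rect = H \<times> Z"
    using jk sets.sets_into_space [OF Z] by (auto simp: rect_def H_def model_def space_pair_measure N_def)
  show "rect \<in> sets (model p n tau eps)"
    unfolding rect model_def N_def [symmetric] using Hs Z by (rule pair_measureI)
  have "emeasure (model p n tau eps) rect = emeasure ?B H * emeasure N Z"
    unfolding rect model_def N_def [symmetric] using Hs Z by (rule N.emeasure_pair_measure_Times)
  also have "emeasure ?B H = ennreal (measure (beta_law tau eps) S * measure (beta_law tau eps) T)"
    unfolding H using jk by (simp add: beta.emeasure_eq_measure ennreal_mult)
  finally have "emeasure (model p n tau eps) rect
      = ennreal (measure (beta_law tau eps) S * measure (beta_law tau eps) T * measure N Z)"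
    unfolding N.emeasure_eq_measure by (simp only: ennreal_mult [symmetric] measure_nonneg mult_nonneg_nonneg)
  then show "measure (model p n tau eps) rect
      = measure (beta_law tau eps) S * measure (beta_law tau eps) T * measure N Z"
    by (intro measure_eq_emeasure_eq_ennreal mult_nonneg_nonneg measure_nonneg)
qed

text \<open>The event is split by the partner's value: 0, tau, or anything else, which is a null set
  of the signal law. \<open>A y\<close> is the noise event left once the partner equals y.\<close>

lemma measure_model_le:
  fixes p n :: nat and tau eps :: real
  defines "N \<equiv> PiM {..<n} (\<lambda>_. std_normal)"
  assumes jk: "j < p" "k < p" "j \<noteq> k" and tau: "tau \<noteq> 0" "0 \<le> eps" "eps \<le> 1"
    and A: "A 0 \<in> sets N" "A tau \<in> sets N"
    and E: "E \<subseteq> {\<omega>\<in>space (model p n tau eps). fst \<omega> j = x \<and> snd \<omega> \<in> A (fst \<omega> k)}"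
  shows "measure (model p n tau eps) E
    \<le> measure (beta_law tau eps) {x} * ((1 - eps) * measure N (A 0) + eps * measure N (A tau))"
proof -
  interpret prob_space "model p n tau eps" by (rule prob_space_model)
  let ?r = "\<lambda>T Z. {\<omega>\<in>space (model p n tau eps). fst \<omega> j \<in> {x} \<and> fst \<omega> k \<in> T \<and> snd \<omega> \<in> Z}"
  note sets = model_rect_sets [OF jk, where n = n, folded N_def] and meas = measure_model_rect [OF jk, where n = n, folded N_def]
  have "E \<subseteq> ?r {0} (A 0) \<union> (?r {tau} (A tau) \<union> ?r (- {0, tau}) (space N))"
  proof
    fix \<omega> assume "\<omega> \<in> E"
    then have "\<omega> \<in> space (model p n tau eps)" "fst \<omega> j = x" "snd \<omega> \<in> A (fst \<omega> k)" using E by auto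
    moreover have "snd \<omega> \<in> space N"
      using \<open>\<omega> \<in> space (model p n tau eps)\<close> by (auto simp: model_def space_pair_measure N_def)
    ultimately show "\<omega> \<in> ?r {0} (A 0) \<union> (?r {tau} (A tau) \<union> ?r (- {0, tau}) (space N))" by auto
  qed
  then have "prob E \<le> prob (?r {0} (A 0) \<union> (?r {tau} (A tau) \<union> ?r (- {0, tau}) (space N)))"
    by (intro finite_measure_mono sets.Un sets A) auto
  also have "\<dots> \<le> prob (?r {0} (A 0)) + (prob (?r {tau} (A tau)) + prob (?r (- {0, tau}) (space N)))"
    by (intro order_trans [OF measure_Un_le] add_left_mono sets.Un sets A) auto
  also have "\<dots> = measure (beta_law tau eps) {x} * ((1 - eps) * measure N (A 0) + eps * measure N (A tau))"
    unfolding meas [OF A(1)] meas [OF A(2)] meas [OF sets.top] measure_beta_law_tau [OF tau]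
      measure_beta_law_0 [OF tau] measure_beta_law_compl [OF tau] by (simp add: algebra_simps)
  finally show ?thesis .
qed

lemma measure_model_ge:
  fixes p n :: nat and tau eps :: real
  defines "N \<equiv> PiM {..<n} (\<lambda>_. std_normal)"
  assumes jk: "j < p" "k < p" "j \<noteq> k" and A: "A \<in> sets N" and E: "E \<in> sets (model p n tau eps)"
    and sub: "\<And>\<omega>. \<omega> \<in> space (model p n tau eps) \<Longrightarrow> fst \<omega> j = x \<Longrightarrow> fst \<omega> k = y \<Longrightarrow> snd \<omega> \<in> A \<Longrightarrow> \<omega> \<in> E"
  shows "measure (beta_law tau eps) {x} * measure (beta_law tau eps) {y} * measure N A
    \<le> measure (model p n tau eps) E"
proof -
  interpret prob_space "model p n tau eps" by (rule prob_space_model)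
  have "prob {\<omega>\<in>space (model p n tau eps). fst \<omega> j \<in> {x} \<and> fst \<omega> k \<in> {y} \<and> snd \<omega> \<in> A} \<le> prob E"
    using sub by (intro finite_measure_mono E) auto
  then show ?thesis unfolding measure_model_rect [OF jk, where n = n, folded N_def, OF A] .
qed

section \<open>Summation over the coordinates\<close>

text \<open>Lower bounds are asked for j < p - 1 only, because the last coordinate may lack a
  partner; p - 1 >= p / 2 terms suffice. Constants and the arbitrarily small loss e are absorbed by
  the notion of a multi-log term.\<close>

lemma is_Lp_sumI:
  fixes P :: "nat \<Rightarrow> nat \<Rightarrow> real"
  assumes nonneg: "\<And>p j. 0 \<le> P p j" and c: "0 < c"
    and upper: "\<forall>\<^sub>F p in sequentially. \<forall>j<p. P p j \<le> C * real p powr (- \<kappa>)"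
    and lower: "\<And>e. 0 < e \<Longrightarrow> \<forall>\<^sub>F p in sequentially. \<forall>j<p - 1. c * real p powr (- (\<kappa> + e)) \<le> P p j"
  shows "is_Lp (\<lambda>p. (\<Sum>j<p. P p j) / real p powr (1 - \<kappa>))"
  unfolding is_Lp_def
proof (intro allI impI conjI)
  fix e :: real assume e: "0 < e"
  have ev: "\<forall>\<^sub>F p in sequentially. (2::nat) \<le> p" by (rule eventually_ge_at_top)
  \<comment> \<open>Half of e pays for the loss in the lower bound; the other half is left to
    diverge.\<close>
  have "\<forall>\<^sub>F p in sequentially. c / 2 * real p powr (e / 2) \<le> (\<Sum>j<p. P p j) / real p powr (1 - \<kappa>) * real p powr e"
    using lower [OF half_gt_zero [OF e]] ev
  proof eventually_elim
    case (elim p)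
    have "real p / 2 * (c * real p powr (- (\<kappa> + e / 2))) \<le> real (p - 1) * (c * real p powr (- (\<kappa> + e / 2)))"
      using elim c by (intro mult_right_mono) auto
    also have "\<dots> = (\<Sum>j<p - 1. c * real p powr (- (\<kappa> + e / 2)))" by simp
    also have "\<dots> \<le> (\<Sum>j<p - 1. P p j)" using elim by (intro sum_mono) auto
    also have "\<dots> \<le> (\<Sum>j<p. P p j)" by (intro sum_mono2 nonneg) auto
    finally have le: "real p / 2 * (c * real p powr (- (\<kappa> + e / 2))) \<le> (\<Sum>j<p. P p j)" .
    define a b where "a = - (\<kappa> + e / 2)" and "b = 1 - \<kappa>"
    have "e / 2 = 1 + a - b + e" by (simp add: a_def b_def)
    then have "real p powr (e / 2) = real p powr (1 + a - b + e)" by (rule arg_cong)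
    also have "\<dots> = real p * real p powr a / real p powr b * real p powr e"
      using elim by (simp add: powr_add powr_diff)
    finally have "c / 2 * real p powr (e / 2)
        = (real p / 2 * (c * real p powr (- (\<kappa> + e / 2)))) / real p powr (1 - \<kappa>) * real p powr e"
      by (simp add: a_def b_def)
    also have "\<dots> \<le> (\<Sum>j<p. P p j) / real p powr (1 - \<kappa>) * real p powr e"
      by (intro mult_right_mono divide_right_mono le) auto
    finally show ?case .
  qed
  moreover have "filterlim (\<lambda>p. c / 2 * real p powr (e / 2)) at_top sequentially"
    using c e by real_asymp
  ultimately show "filterlim (\<lambda>p. (\<Sum>j<p. P p j) / real p powr (1 - \<kappa>) * real p powr e) at_top sequentially"
    by (rule filterlim_at_top_mono [rotated])
  have up: "\<forall>\<^sub>F p in sequentially. (\<Sum>j<p. P p j) / real p powr (1 - \<kappa>) * real p powr (- e) \<le> C * real p powr (- e)"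
    using upper ev
  proof eventually_elim
    case (elim p)
    have "(\<Sum>j<p. P p j) \<le> (\<Sum>j<p. C * real p powr (- \<kappa>))" using elim by (intro sum_mono) auto
    also have "\<dots> = C * real p powr (1 - \<kappa>)"
      using elim by (simp add: powr_diff powr_minus divide_inverse)
    finally have "(\<Sum>j<p. P p j) / real p powr (1 - \<kappa>) \<le> C"
      using elim by (simp add: divide_le_eq)
    then show ?case by (intro mult_right_mono) auto
  qed
  have low: "\<forall>\<^sub>F p in sequentially. 0 \<le> (\<Sum>j<p. P p j) / real p powr (1 - \<kappa>) * real p powr (- e)"
    by (intro always_eventually allI mult_nonneg_nonneg divide_nonneg_nonneg sum_nonneg nonneg) auto
  have lim: "(\<lambda>p. C * real p powr (- e)) \<longlonglongrightarrow> 0" using e by real_asymp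
  show "(\<lambda>p. (\<Sum>j<p. P p j) / real p powr (1 - \<kappa>) * real p powr (- e)) \<longlonglongrightarrow> 0"
    by (rule tendsto_sandwich [OF low up tendsto_const lim])
qed

section \<open>Error probabilities of a single coordinate\<close>

text \<open>Q and R stand for the square roots of q and r: the penalty and the signal strength in
  units of \<open>logscale\<close>.\<close>

locale block_design =
  fixes \<rho> \<mu> Q R \<theta> :: real and n :: "nat \<Rightarrow> nat" and X :: "nat \<Rightarrow> nat \<Rightarrow> nat \<Rightarrow> real"
  assumes rho: "\<bar>\<rho>\<bar> < 1" and mu: "0 < \<mu>" and Q: "0 < Q" and R: "0 < R" and theta: "0 < \<theta>"
    and design: "\<And>p j k. j < p \<Longrightarrow> k < p \<Longrightarrow> (\<Sum>i<n p. X p i j * X p i k) = gram \<rho> j k"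
begin

abbreviation "\<eta> \<equiv> \<rho> / (1 + \<mu>)"
abbreviation "tau p \<equiv> R * logscale p"
abbreviation "eps p \<equiv> real p powr (- \<theta>)"
abbreviation "mdl p \<equiv> model p (n p) (tau p) (eps p)"
abbreviation "noise p \<equiv> PiM {..<n p} (\<lambda>_. std_normal)"
abbreviation "G p j z \<equiv> score (n p) (X p) z j"
abbreviation "coef p \<omega> j \<equiv> enet (n p) p (X p) (Q * logscale p) \<mu> (response (n p) p (X p) (fst \<omega>) (snd \<omega>)) j"

lemma compat: "compatible \<rho> \<eta>"
  using compatible_shrink rho mu .

lemma eps_bounds: "2 \<le> p \<Longrightarrow> 0 < eps p \<and> eps p < 1"
  using theta powr_less_mono [of "- \<theta>" 0 "real p"] by simp

lemma tau_pos: "2 \<le> p \<Longrightarrow> 0 < tau p"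
  using R logscale_pos by simp

text \<open>Soft thresholding is positively homogeneous, so dividing by \<open>logscale\<close>
  turns the zero criterion into membership in a region independent of p. The centre is the block of
  the Gram matrix applied to the two coefficients.\<close>

lemma coef_zero_iff:
  assumes p: "2 \<le> p" and j: "j < p" "nbr j < p"
  shows "coef p \<omega> j = 0 \<longleftrightarrow>
    rescaled ((fst \<omega> j + \<rho> * fst \<omega> (nbr j)) / logscale p, (fst \<omega> (nbr j) + \<rho> * fst \<omega> j) / logscale p)
      (G p j) (G p (nbr j)) p (snd \<omega>) \<in> dead \<eta> Q"
proof -
  define s where "s = logscale p"
  have s: "0 < s" using p by (simp add: s_def logscale_pos)
  define x1 x2 where "x1 = (fst \<omega> j + \<rho> * fst \<omega> (nbr j)) / s + G p j (snd \<omega>) / s"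
    and "x2 = (fst \<omega> (nbr j) + \<rho> * fst \<omega> j) / s + G p (nbr j) (snd \<omega>) / s"
  have w: "score (n p) (X p) (response (n p) p (X p) (fst \<omega>) (snd \<omega>)) j = x1 * s"
    "score (n p) (X p) (response (n p) p (X p) (fst \<omega>) (snd \<omega>)) (nbr j) = x2 * s"
    using s j by (simp_all add: score_response [OF design] x1_def x2_def add_divide_distrib [symmetric])
  have "coef p \<omega> j = 0 \<longleftrightarrow> \<bar>x1 * s - \<eta> * soft (Q * s) (x2 * s)\<bar> \<le> Q * s"
    using enet_zero_iff [OF mu _ rho design j(1), where l = "Q * s" and y = "response (n p) p (X p) (fst \<omega>) (snd \<omega>)"]
      Q s j(2) by (simp add: w s_def [symmetric])
  also have "x1 * s - \<eta> * soft (Q * s) (x2 * s) = (x1 - \<eta> * soft Q x2) * s"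
    by (simp add: soft_scale [OF s] left_diff_distrib)
  also have "\<bar>(x1 - \<eta> * soft Q x2) * s\<bar> \<le> Q * s \<longleftrightarrow> \<bar>x1 - \<eta> * soft Q x2\<bar> \<le> Q"
    using s by (simp add: abs_mult)
  finally show ?thesis by (simp add: dead_def rescaled_def x1_def x2_def s_def)
qed

lemma coef_zero_iff_single:
  assumes p: "2 \<le> p" and j: "j < p" "p \<le> nbr j"
  shows "coef p \<omega> j = 0 \<longleftrightarrow> \<bar>fst \<omega> j + G p j (snd \<omega>)\<bar> \<le> Q * logscale p"
  using enet_zero_iff [OF mu _ rho design j(1), where l = "Q * logscale p" and y = "response (n p) p (X p) (fst \<omega>) (snd \<omega>)"]
    Q j logscale_pos [OF p] by (simp add: score_response [OF design])

lemma gauss_pair_nbr: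
  assumes "j < p" "nbr j < p"
  shows "gauss_pair \<rho> (noise p) (G p j) (G p (nbr j))"
proof -
  have "gram \<rho> j (nbr j) = \<rho>" using div2_eq_iff [of j "nbr j"] by (simp add: gram_def)
  then show ?thesis using gauss_pair_score [OF design assms] by simp
qed

text \<open>A block of size one fits into the framework of pairs by taking the same score twice;
  correlation 1 is harmless because \<open>gauss_pair\<close> speaks only about combinations of
  positive variance.\<close>

lemma gauss_pair_single: "j < p \<Longrightarrow> gauss_pair 1 (noise p) (G p j) (G p j)"
proof -
  assume j: "j < p"
  show ?thesis using gauss_pair_score [OF design j j] by (simp add: gram_def)
qed

lemma G_measurable [measurable]: "G p j \<in> borel_measurable (noise p)"
  unfolding score_def by measurable

lemma fst_measurable: "j < p \<Longrightarrow> (\<lambda>\<omega>. fst \<omega> j) \<in> borel_measurable (mdl p)"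
proof -
  assume j: "j < p"
  have "(\<lambda>\<beta>. \<beta> j) \<in> measurable (PiM {..<p} (\<lambda>_. beta_law (tau p) (eps p))) (beta_law (tau p) (eps p))"
    using j by simp
  moreover have "(\<lambda>x. x) \<in> borel_measurable (beta_law (tau p) (eps p))"
    by (simp add: measurable_def)
  ultimately have "(\<lambda>\<beta>. \<beta> j) \<in> borel_measurable (PiM {..<p} (\<lambda>_. beta_law (tau p) (eps p)))"
    by (rule measurable_compose)
  then show ?thesis unfolding model_def by (rule measurable_compose [OF measurable_fst])
qed

text \<open>\<open>enet\<close> is a definite description, so measurability is obtained through the
  explicit zero criterion.\<close>

lemma
  assumes p: "2 \<le> p" and j: "j < p" "nbr j < p"
  shows zero_event: "{\<omega>\<in>space (mdl p). fst \<omega> j = x \<and> coef p \<omega> j = 0} \<in> sets (mdl p)"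
    and nonzero_event: "{\<omega>\<in>space (mdl p). fst \<omega> j = x \<and> coef p \<omega> j \<noteq> 0} \<in> sets (mdl p)"
proof -
  note [measurable] = fst_measurable [OF j(1)] fst_measurable [OF j(2)]
  have [measurable]: "dead \<eta> Q \<in> sets borel" using closed_dead by (rule borel_closed)
  have [measurable]: "(\<lambda>\<omega>. G p i (snd \<omega>)) \<in> borel_measurable (mdl p)" for i
    unfolding model_def by measurable
  show "{\<omega>\<in>space (mdl p). fst \<omega> j = x \<and> coef p \<omega> j = 0} \<in> sets (mdl p)"
    "{\<omega>\<in>space (mdl p). fst \<omega> j = x \<and> coef p \<omega> j \<noteq> 0} \<in> sets (mdl p)"
    unfolding coef_zero_iff [OF p j] rescaled_def fst_conv snd_conv by measurable
qed

lemma noise_event: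
  "{z\<in>space (noise p). rescaled c (G p j) (G p k) p z \<in> dead \<eta> Q} \<in> sets (noise p)"
  "{z\<in>space (noise p). rescaled c (G p j) (G p k) p z \<notin> dead \<eta> Q} \<in> sets (noise p)"
proof -
  have [measurable]: "dead \<eta> Q \<in> sets borel" using closed_dead by (rule borel_closed)
  show "{z\<in>space (noise p). rescaled c (G p j) (G p k) p z \<in> dead \<eta> Q} \<in> sets (noise p)"
    "{z\<in>space (noise p). rescaled c (G p j) (G p k) p z \<notin> dead \<eta> Q} \<in> sets (noise p)"
    by measurable
qed

lemma powr_weight: "eps p * real p powr (- k) = real p powr (- (\<theta> + k))"
  by (simp add: powr_add [symmetric])

lemma false_positive_le:
  assumes p: "2 \<le> p" and j: "j < p"
  shows "measure (mdl p) {\<omega>\<in>space (mdl p). fst \<omega> j = 0 \<and> coef p \<omega> j \<noteq> 0}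
    \<le> 8 * real p powr (- min (Q\<^sup>2) (\<theta> + f1 \<rho> \<eta> R Q))"
proof -
  let ?\<kappa> = "min (Q\<^sup>2) (\<theta> + f1 \<rho> \<eta> R Q)"
  let ?E = "{\<omega>\<in>space (mdl p). fst \<omega> j = 0 \<and> coef p \<omega> j \<noteq> 0}"
  have s: "0 < logscale p" using p by (rule logscale_pos)
  have e: "0 \<le> eps p" "eps p \<le> 1" using eps_bounds [OF p] by auto
  have tau: "tau p \<noteq> 0" using tau_pos [OF p] by (rule less_imp_neq [THEN not_sym])
  have w0: "measure (beta_law (tau p) (eps p)) {0} \<le> 1"
    by (rule prob_space.prob_le_1 [OF prob_space_beta_law])
  have mono: "real p powr (- k) \<le> real p powr (- ?\<kappa>)" if "?\<kappa> \<le> k" for k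
    using that p by (intro powr_mono) auto
  show ?thesis
  proof (cases "nbr j < p")
    case True
    define A where "A y = {z\<in>space (noise p). rescaled ((0 + \<rho> * y) / logscale p, (y + \<rho> * 0) / logscale p)
        (G p j) (G p (nbr j)) p z \<notin> dead \<eta> Q}" for y
    have A: "A y \<in> sets (noise p)" for y unfolding A_def by (rule noise_event)
    have "?E \<subseteq> {\<omega>\<in>space (mdl p). fst \<omega> j = 0 \<and> snd \<omega> \<in> A (fst \<omega> (nbr j))}"
      unfolding coef_zero_iff [OF p j True] by (auto simp: A_def model_def space_pair_measure)
    from measure_model_le [OF j True _ tau e A A this]
    have "measure (mdl p) ?E \<le> measure (beta_law (tau p) (eps p)) {0}
        * ((1 - eps p) * measure (noise p) (A 0) + eps p * measure (noise p) (A (tau p)))" by simp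
    also have "\<dots> \<le> 1 * (1 * (4 * real p powr (- Q\<^sup>2)) + eps p * (4 * real p powr (- min (Q\<^sup>2) (f1 \<rho> \<eta> R Q))))"
    proof (intro mult_mono add_mono w0)
      show "measure (noise p) (A 0) \<le> 4 * real p powr (- Q\<^sup>2)"
        using null_active_le [OF rho Q gauss_pair_nbr [OF j True] p, of \<eta>] by (simp add: A_def)
      show "measure (noise p) (A (tau p)) \<le> 4 * real p powr (- min (Q\<^sup>2) (f1 \<rho> \<eta> R Q))"
        using neighbour_active_le' [OF compat Q R gauss_pair_nbr [OF j True] p] s by (simp add: A_def)
    qed (use e in \<open>auto intro!: add_nonneg_nonneg mult_nonneg_nonneg\<close>)
    also have "\<dots> = 4 * real p powr (- Q\<^sup>2) + 4 * real p powr (- (\<theta> + min (Q\<^sup>2) (f1 \<rho> \<eta> R Q)))"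
      unfolding powr_weight [symmetric] by simp
    \<comment> \<open>The capped rate of the neighbour case is enough: theta + min (Q^2, f1) is at
      least min (Q^2, theta + f1), as theta > 0.\<close>
    also have "\<dots> \<le> 4 * real p powr (- ?\<kappa>) + 4 * real p powr (- ?\<kappa>)"
      using theta by (intro add_mono mult_left_mono mono) auto
    finally show ?thesis by simp
  next
    case False
    then have nbr: "p \<le> nbr j" by simp
    \<comment> \<open>Any second index will do: the two-coordinate product formula asks for one, and
      the same noise event is used whatever its value.\<close>
    obtain k where k: "k < p" "j \<noteq> k" 
      using p by (intro that [of "if j = 0 then 1 else 0"]) auto
    define B where "B = {z\<in>space (noise p). Q * logscale p \<le> 1 * G p j z + 0 * G p j z}
        \<union> {z\<in>space (noise p). Q * logscale p \<le> - 1 * G p j z + 0 * G p j z}"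
    have B: "B \<in> sets (noise p)" unfolding B_def by measurable
    have "?E \<subseteq> {\<omega>\<in>space (mdl p). fst \<omega> j = 0 \<and> snd \<omega> \<in> B}"
      unfolding coef_zero_iff_single [OF p j nbr]
      by (auto simp: B_def model_def space_pair_measure not_le abs_if split: if_splits)
    from measure_model_le [OF j k tau e _ _ this] B
    have "measure (mdl p) ?E \<le> measure (beta_law (tau p) (eps p)) {0} * measure (noise p) B"
      by (simp add: algebra_simps)
    also have "\<dots> \<le> measure (noise p) B" using w0 by (simp add: mult_left_le_one_le)
    also have "\<dots> \<le> real p powr (- Q\<^sup>2) + real p powr (- Q\<^sup>2)"
      unfolding B_def
    proof (intro order_trans [OF measure_Un_le] add_mono)
      show "measure (noise p) {z\<in>space (noise p). Q * logscale p \<le> 1 * G p j z + 0 * G p j z} \<le> real p powr (- Q\<^sup>2)"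
        using halfplane_le [OF gauss_pair_single [OF j] refl _ p, of 1 0 Q] Q by (simp add: covq_def pospart_def)
      show "measure (noise p) {z\<in>space (noise p). Q * logscale p \<le> - 1 * G p j z + 0 * G p j z} \<le> real p powr (- Q\<^sup>2)"
        using halfplane_le [OF gauss_pair_single [OF j] refl _ p, of "- 1" 0 Q] Q by (simp add: covq_def pospart_def)
    qed measurable
    also have "\<dots> \<le> 8 * real p powr (- ?\<kappa>)" 
      using mono [OF min.cobounded1] powr_ge_zero [of "real p" "- ?\<kappa>"] by linarith
    finally show ?thesis .
  qed
qed

lemma false_negative_le:
  assumes p: "2 \<le> p" and j: "j < p"
  shows "measure (mdl p) {\<omega>\<in>space (mdl p). fst \<omega> j = tau p \<and> coef p \<omega> j = 0}
    \<le> 4 * real p powr (- min (\<theta> + f2 \<rho> \<eta> R Q) (2 * \<theta> + f3 \<rho> \<eta> R Q))"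
proof -
  let ?\<kappa> = "min (\<theta> + f2 \<rho> \<eta> R Q) (2 * \<theta> + f3 \<rho> \<eta> R Q)"
  let ?E = "{\<omega>\<in>space (mdl p). fst \<omega> j = tau p \<and> coef p \<omega> j = 0}"
  have s: "0 < logscale p" using p by (rule logscale_pos)
  have e: "0 \<le> eps p" "eps p \<le> 1" using eps_bounds [OF p] by auto
  have tau: "tau p \<noteq> 0" using tau_pos [OF p] by (rule less_imp_neq [THEN not_sym])
  have mono: "real p powr (- k) \<le> real p powr (- ?\<kappa>)" if "?\<kappa> \<le> k" for k
    using that p by (intro powr_mono) auto
  show ?thesis
  proof (cases "nbr j < p")
    case True
    define A where "A y = {z\<in>space (noise p). rescaled ((tau p + \<rho> * y) / logscale p, (y + \<rho> * tau p) / logscale p)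
        (G p j) (G p (nbr j)) p z \<in> dead \<eta> Q}" for y
    have A: "A y \<in> sets (noise p)" for y unfolding A_def by (rule noise_event)
    have "?E \<subseteq> {\<omega>\<in>space (mdl p). fst \<omega> j = tau p \<and> snd \<omega> \<in> A (fst \<omega> (nbr j))}"
      unfolding coef_zero_iff [OF p j True] by (auto simp: A_def model_def space_pair_measure)
    from measure_model_le [OF j True _ tau e A A this]
    have "measure (mdl p) ?E
        \<le> eps p * ((1 - eps p) * measure (noise p) (A 0) + eps p * measure (noise p) (A (tau p)))"
      by (simp add: measure_beta_law_tau [OF tau e])
    also have "\<dots> \<le> eps p * (1 * (2 * real p powr (- f2 \<rho> \<eta> R Q)) + eps p * (2 * real p powr (- f3 \<rho> \<eta> R Q)))"
    proof (intro mult_left_mono add_mono mult_mono)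
      show "measure (noise p) (A 0) \<le> 2 * real p powr (- f2 \<rho> \<eta> R Q)"
        using signal_dead_le' [OF compat Q R gauss_pair_nbr [OF j True] p] s by (simp add: A_def)
      have "(tau p + \<rho> * tau p) / logscale p = (1 + \<rho>) * R" using s by (simp add: field_simps)
      then show "measure (noise p) (A (tau p)) \<le> 2 * real p powr (- f3 \<rho> \<eta> R Q)"
        using two_signals_dead_le [OF rho _ Q R gauss_pair_nbr [OF j True] p] compat
        by (auto simp: A_def compatible_def)
    qed (use e in auto)
    also have "\<dots> = 2 * real p powr (- (\<theta> + f2 \<rho> \<eta> R Q)) + 2 * real p powr (- (\<theta> + (\<theta> + f3 \<rho> \<eta> R Q)))"
      unfolding powr_weight [symmetric] by (simp add: algebra_simps)
    also have "\<dots> \<le> 2 * real p powr (- ?\<kappa>) + 2 * real p powr (- ?\<kappa>)"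
      by (intro add_mono mult_left_mono mono) auto
    finally show ?thesis by simp
  next
    case False
    then have nbr: "p \<le> nbr j" by simp
    obtain k where k: "k < p" "j \<noteq> k" 
      using p by (intro that [of "if j = 0 then 1 else 0"]) auto
    define B where "B = {z\<in>space (noise p). (R - Q) * logscale p \<le> - 1 * G p j z + 0 * G p j z}"
    have B: "B \<in> sets (noise p)" unfolding B_def by measurable
    have "?E \<subseteq> {\<omega>\<in>space (mdl p). fst \<omega> j = tau p \<and> snd \<omega> \<in> B}"
      unfolding coef_zero_iff_single [OF p j nbr]
      by (auto simp: B_def model_def space_pair_measure abs_le_iff algebra_simps)
    from measure_model_le [OF j k tau e _ _ this] B
    have "measure (mdl p) ?E \<le> eps p * measure (noise p) B"
      by (simp add: measure_beta_law_tau [OF tau e] algebra_simps)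
    also have "\<dots> \<le> eps p * real p powr (- (pospart (R - Q))\<^sup>2)"
      using halfplane_le [OF gauss_pair_single [OF j] refl _ p, of "- 1" 0 "R - Q"]
      by (intro mult_left_mono e) (simp add: covq_def B_def)
    also have "\<dots> = real p powr (- (\<theta> + (pospart (R - Q))\<^sup>2))" by (rule powr_weight)
    \<comment> \<open>The rate of an unpaired signal, (R - Q)_+^2, is one of the two terms whose
      minimum is \<open>f2\<close>.\<close>
    also have "\<dots> \<le> real p powr (- ?\<kappa>)" by (intro mono) (auto simp: f2_def min_def)
    also have "\<dots> \<le> 4 * real p powr (- ?\<kappa>)" by simp
    finally show ?thesis .
  qed
qed

lemma eventually_eps_le_half: "\<forall>\<^sub>F p in sequentially. eps p \<le> 1 / 2"
proof -
  have "(\<lambda>p. eps p) \<longlonglongrightarrow> 0" using theta by real_asymp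
  then have "\<forall>\<^sub>F p in sequentially. eps p < 1 / 2" by (rule order_tendstoD) simp
  then show ?thesis by eventually_elim simp
qed

lemma nbr_less: "j < p - 1 \<Longrightarrow> j < p \<and> nbr j < p"
  by (auto simp: nbr_def)

text \<open>Either value of the partner gives a lower bound, with weights (1 - eps)^2 >= 1/4 and (1
  - eps) eps >= eps / 2; the cheaper configuration attains the minimum in the exponent.\<close>

lemma false_positive_ge:
  assumes d: "0 < d"
  shows "\<forall>\<^sub>F p in sequentially. \<forall>j<p - 1. 1 / 4 * real p powr (- (min (Q\<^sup>2) (\<theta> + f1 \<rho> \<eta> R Q) + d))
    \<le> measure (mdl p) {\<omega>\<in>space (mdl p). fst \<omega> j = 0 \<and> coef p \<omega> j \<noteq> 0}"
  using null_active_ge [OF rho Q d, of \<eta>, where 'a = "nat \<Rightarrow> real"]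
    neighbour_active_ge' [OF compat Q R d, where 'a = "nat \<Rightarrow> real"]
    eventually_eps_le_half eventually_ge_at_top [of 2]
proof eventually_elim
  case (elim p)
  note p = elim(4)
  show ?case
  proof (intro allI impI)
    fix j assume "j < p - 1"
    then have j: "j < p" "nbr j < p" using nbr_less by auto
    let ?E = "{\<omega>\<in>space (mdl p). fst \<omega> j = 0 \<and> coef p \<omega> j \<noteq> 0}"
    note G = gauss_pair_nbr [OF j]
    have s: "0 < logscale p" using p by (rule logscale_pos)
    have e: "0 \<le> eps p" "eps p \<le> 1" using eps_bounds [OF p] by auto
    have tau: "tau p \<noteq> 0" using tau_pos [OF p] by (rule less_imp_neq [THEN not_sym])
    have w: "1 / 2 \<le> 1 - eps p" using elim(3) by simp
    have "1 / 2 * (1 / 2) * real p powr (- (Q\<^sup>2 + d)) \<le> (1 - eps p) * (1 - eps p) * measure (noise p)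
        {z\<in>space (noise p). rescaled (0, 0) (G p j) (G p (nbr j)) p z \<notin> dead \<eta> Q}"
      using w elim(1) G by (intro mult_mono) auto
    also have "\<dots> \<le> measure (mdl p) ?E"
      using measure_model_ge [where x = 0 and y = 0, OF j _ noise_event(2) [where c = "(0, 0)" and j = j and k = "nbr j"]
            nonzero_event [OF p j, where x = 0]]
      by (simp add: coef_zero_iff [OF p j] measure_beta_law_0 [OF tau e])
    finally have 1: "1 / 4 * real p powr (- (Q\<^sup>2 + d)) \<le> measure (mdl p) ?E" by simp
    have "1 / 4 * real p powr (- (\<theta> + f1 \<rho> \<eta> R Q + d)) \<le> 1 / 2 * real p powr (- (\<theta> + (f1 \<rho> \<eta> R Q + d)))"
      by (simp add: add.assoc)
    also have "\<dots> = 1 / 2 * eps p * real p powr (- (f1 \<rho> \<eta> R Q + d))"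
      unfolding powr_weight [symmetric] by simp
    also have "\<dots> \<le> (1 - eps p) * eps p * measure (noise p)
        {z\<in>space (noise p). rescaled (\<rho> * R, R) (G p j) (G p (nbr j)) p z \<notin> dead \<eta> Q}"
      using w e elim(2) G by (intro mult_mono) auto
    also have "\<dots> \<le> measure (mdl p) ?E"
      using measure_model_ge [where x = 0 and y = "tau p", OF j _ noise_event(2) [where c = "(\<rho> * R, R)" and j = j and k = "nbr j"]
            nonzero_event [OF p j, where x = 0]] s
      by (simp add: coef_zero_iff [OF p j] measure_beta_law_0 [OF tau e] measure_beta_law_tau [OF tau e])
    finally show "1 / 4 * real p powr (- (min (Q\<^sup>2) (\<theta> + f1 \<rho> \<eta> R Q) + d)) \<le> measure (mdl p) ?E"
      using 1 by (cases "Q\<^sup>2 \<le> \<theta> + f1 \<rho> \<eta> R Q") (simp_all add: min_def)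
  qed
qed

text \<open>The two configurations carry weights eps (1 - eps) and eps^2, which add theta and 2
  theta to the exponents \<open>f2\<close> and \<open>f3\<close>; the cheaper one attains the
  minimum.\<close>

lemma false_negative_ge:
  assumes d: "0 < d"
  shows "\<forall>\<^sub>F p in sequentially. \<forall>j<p - 1.
    1 / 2 * real p powr (- (min (\<theta> + f2 \<rho> \<eta> R Q) (2 * \<theta> + f3 \<rho> \<eta> R Q) + d))
    \<le> measure (mdl p) {\<omega>\<in>space (mdl p). fst \<omega> j = tau p \<and> coef p \<omega> j = 0}"
proof -
  have sgn: "0 \<le> \<eta> \<and> \<eta> \<le> \<rho> \<or> \<rho> \<le> \<eta> \<and> \<eta> \<le> 0" using compat by (auto simp: compatible_def)
  show ?thesis
    using signal_dead_ge' [OF compat Q R d, where 'a = "nat \<Rightarrow> real"]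
      two_signals_dead_ge [OF rho sgn Q R d, where 'a = "nat \<Rightarrow> real"]
      eventually_eps_le_half eventually_ge_at_top [of 2]
  proof eventually_elim
    case (elim p)
    note p = elim(4)
    show ?case
    proof (intro allI impI)
      fix j assume "j < p - 1"
      then have j: "j < p" "nbr j < p" using nbr_less by auto
      let ?E = "{\<omega>\<in>space (mdl p). fst \<omega> j = tau p \<and> coef p \<omega> j = 0}"
      note G = gauss_pair_nbr [OF j]
      have s: "0 < logscale p" using p by (rule logscale_pos)
      have e: "0 \<le> eps p" "eps p \<le> 1" using eps_bounds [OF p] by auto
      have tau: "tau p \<noteq> 0" using tau_pos [OF p] by (rule less_imp_neq [THEN not_sym])
      have w: "1 / 2 \<le> 1 - eps p" using elim(3) by simp
      have "1 / 2 * real p powr (- (\<theta> + f2 \<rho> \<eta> R Q + d)) = eps p * (1 / 2) * real p powr (- (f2 \<rho> \<eta> R Q + d))"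
        unfolding add.assoc powr_weight [symmetric] by simp
      also have "\<dots> \<le> eps p * (1 - eps p) * measure (noise p)
          {z\<in>space (noise p). rescaled (R, \<rho> * R) (G p j) (G p (nbr j)) p z \<in> dead \<eta> Q}"
        using w e elim(1) G by (intro mult_mono) auto
      also have "\<dots> \<le> measure (mdl p) ?E"
        using measure_model_ge [where x = "tau p" and y = 0, OF j _ noise_event(1) [where c = "(R, \<rho> * R)" and j = j and k = "nbr j"]
            zero_event [OF p j, where x = "tau p"]] s
        by (simp add: coef_zero_iff [OF p j] measure_beta_law_0 [OF tau e] measure_beta_law_tau [OF tau e])
      finally have 1: "1 / 2 * real p powr (- (\<theta> + f2 \<rho> \<eta> R Q + d)) \<le> measure (mdl p) ?E" .
      have "1 / 2 * real p powr (- (2 * \<theta> + f3 \<rho> \<eta> R Q + d)) \<le> real p powr (- (\<theta> + (\<theta> + (f3 \<rho> \<eta> R Q + d))))"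
        by (simp add: add.assoc)
      also have "\<dots> = eps p * eps p * real p powr (- (f3 \<rho> \<eta> R Q + d))"
        unfolding powr_weight [symmetric] by simp
      also have "\<dots> \<le> eps p * eps p * measure (noise p)
          {z\<in>space (noise p). rescaled ((1 + \<rho>) * R, (1 + \<rho>) * R) (G p j) (G p (nbr j)) p z \<in> dead \<eta> Q}"
        using e elim(2) G by (intro mult_left_mono) auto
      also have "\<dots> \<le> measure (mdl p) ?E"
      proof -
        have "(tau p + \<rho> * tau p) / logscale p = (1 + \<rho>) * R" using s by (simp add: field_simps)
        then show ?thesis
          using measure_model_ge [where x = "tau p" and y = "tau p", OF j _ noise_event(1) [where c = "((1 + \<rho>) * R, (1 + \<rho>) * R)" and j = j and k = "nbr j"]
            zero_event [OF p j, where x = "tau p"]]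
          by (simp add: coef_zero_iff [OF p j] measure_beta_law_tau [OF tau e])
      qed
      finally show "1 / 2 * real p powr (- (min (\<theta> + f2 \<rho> \<eta> R Q) (2 * \<theta> + f3 \<rho> \<eta> R Q) + d)) \<le> measure (mdl p) ?E"
        using 1 by (cases "\<theta> + f2 \<rho> \<eta> R Q \<le> 2 * \<theta> + f3 \<rho> \<eta> R Q") (simp_all add: min_def)
    qed
  qed
qed

lemma enet_FP_is_Lp:
  "is_Lp (\<lambda>p. enet_FP p (n p) (X p) (tau p) (eps p) (Q * logscale p) \<mu>
    / real p powr (1 - min (Q\<^sup>2) (\<theta> + f1 \<rho> \<eta> R Q)))"
  unfolding enet_FP_def
proof (rule is_Lp_sumI [where c = "1 / 4"])
  show "\<forall>\<^sub>F p in sequentially. \<forall>j<p. measure (mdl p) {\<omega>\<in>space (mdl p). fst \<omega> j = 0 \<and> coef p \<omega> j \<noteq> 0}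
    \<le> 8 * real p powr (- min (Q\<^sup>2) (\<theta> + f1 \<rho> \<eta> R Q))"
    using eventually_ge_at_top [of 2] by eventually_elim (blast intro: false_positive_le)
qed (rule measure_nonneg false_positive_ge | simp)+

lemma enet_FN_is_Lp:
  "is_Lp (\<lambda>p. enet_FN p (n p) (X p) (tau p) (eps p) (Q * logscale p) \<mu>
    / real p powr (1 - min (\<theta> + f2 \<rho> \<eta> R Q) (2 * \<theta> + f3 \<rho> \<eta> R Q)))"
  unfolding enet_FN_def
proof (rule is_Lp_sumI [where c = "1 / 2"])
  show "\<forall>\<^sub>F p in sequentially. \<forall>j<p. measure (mdl p) {\<omega>\<in>space (mdl p). fst \<omega> j = tau p \<and> coef p \<omega> j = 0}
    \<le> 4 * real p powr (- min (\<theta> + f2 \<rho> \<eta> R Q) (2 * \<theta> + f3 \<rho> \<eta> R Q))"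
    using eventually_ge_at_top [of 2] by eventually_elim (blast intro: false_negative_le)
qed (rule measure_nonneg false_negative_ge | simp)+

end

theorem theoremB1:
  fixes \<rho> \<theta> r q \<mu> :: real
    and n :: "nat \<Rightarrow> nat"
    and X :: "nat \<Rightarrow> nat \<Rightarrow> nat \<Rightarrow> real"
  assumes rho: "-1 < \<rho>" "\<rho> < 1"
    and theta: "0 < \<theta>" "\<theta> < 1"
    and r: "0 < r" and q: "0 < q" and mu: "0 < \<mu>"
    and design: "\<And>p j k. j < p \<Longrightarrow> k < p \<Longrightarrow>
                   (\<Sum>i<n p. X p i j * X p i k) = gram \<rho> j k"
  shows "is_Lp (\<lambda>p. enet_FP p (n p) (X p) (sqrt (2 * r * ln (real p))) (real p powr (- \<theta>))
                          (sqrt (2 * q * ln (real p))) \<mu>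
                    / real p powr (1 - min q (\<theta> + f1 \<rho> (\<rho> / (1 + \<mu>)) (sqrt r) (sqrt q))))
       \<and> is_Lp (\<lambda>p. enet_FN p (n p) (X p) (sqrt (2 * r * ln (real p))) (real p powr (- \<theta>))
                          (sqrt (2 * q * ln (real p))) \<mu>
                    / real p powr (1 - min (\<theta> + f2 \<rho> (\<rho> / (1 + \<mu>)) (sqrt r) (sqrt q))
                                          (2 * \<theta> + f3 \<rho> (\<rho> / (1 + \<mu>)) (sqrt r) (sqrt q))))"
proof -
  interpret block_design \<rho> \<mu> "sqrt q" "sqrt r" \<theta> n X
    using assms by unfold_locales auto
  have "sqrt (2 * x * ln (real p)) = sqrt x * logscale p" for x p
    by (simp add: logscale_def real_sqrt_mult)
  then show ?thesis using enet_FP_is_Lp enet_FN_is_Lp q by simp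
qed

end
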